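(* Let $f(t)$ be a monic polynomial of degree $2$ with integer coefficients, with constant coefficient $-1$ and $f(1)=\pm1$. Let $k$ be a knot, with group $\pi$, whose Alexander polynomial is $\Delta(t)= f(t)f(t^{-1})$ (up to multiplication by units $\pm t^i$). Let $C\in\mathrm{SL}_3\mathbb Z$ be the companion matrix of $(t-1)f(t)$, and let $\gamma:\pi\to\mathrm{SL}_3\mathbb Z$ be the cyclic representation sending each generator $x_0,x_1,\ldots,x_m$ of a Wirtinger presentation of $\pi$ to $C$. If $f(t)$ is non-reciprocal, then $\tau_\gamma(t)$ (which is considered up to multiplication by units $\pm t^i$) is a non-reciprocal integral polynomial of the form $(t-1)h(t)$, with $h(t)$ a polynomial.
   Context: Let $X$ be the exterior of the knot $k$ and $\pi=\pi_1(X)$. Fix a Wirtinger presentation $\langle x_0,x_1,\ldots,x_m\mid r_1,\ldots,r_m\rangle$ of $\pi$. Let $\epsilon:\pi\to H_1(X;\mathbb Z)\cong\langle t\mid\ \rangle$ be the abelianization sending every $x_i$ to $t$; write $t^{\epsilon(g)}$ for the image of $g$. For a representation $\gamma:\pi\to \mathrm{SL}_n\mathbb C$, let $\Phi:\mathbb Z[\pi]\to M_n(\mathbb C[t^{\pm1}])$ be the ring homomorphism with $\Phi(g)=t^{\epsilon(g)}\gamma(g)$ for $g\in\pi$; it is also applied to elements of the group ring of the free group $F$ on $x_0,\ldots,x_m$ via the projection $F\to\pi$. Let $M_{\gamma\otimes\epsilon}$ be the $m\times(m+1)$ block matrix whose $(i,j)$ block is the $n\times n$ matrix $\Phi(\partial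 r_i/\partial x_j)$, where $\partial r_i/\partial x_j$ is the Fox partial derivative, and let $M^0_{\gamma\otimes\epsilon}$ be the $mn\times mn$ matrix obtained by deleting the block column corresponding to $x_0$. When $\det M^0_{\gamma\otimes\epsilon}\neq 0$, the torsion $\tau_\gamma(t)$ is the Reidemeister torsion of the twisted chain complex $(\mathbb C(t)\otimes_{\mathbb C}\mathbb C^n)\otimes_{\gamma} C_*(\tilde X)$, where $\tilde X$ is the universal cover of $X$, the group ring $\mathbb Z[\pi]$ acts on the left of the cellular chain complex $C_*(\tilde X)$ by deck transformations, and $\pi$ acts on the right of $\mathbb C(t)\otimes\mathbb C^n$ by $(p\otimes v)\cdot g=(pt^{\epsilon(g)})\otimes(v\gamma(g))$. It coincides with the Wada invariant $$\frac{\det M^0_{\gamma\otimes\epsilon}}{\det\Phi(x_0-1)}.$$ When $\gamma$ is the trivial $1$-dimensional representation, $\det M^0_{\gamma\otimes\epsilon}$ is the Alexander polynomial $\Delta(t)$ of $k$, an integral Laurent polynomial well defined up to multiplication by units $\pm t^i\in\mathbb Z[t^{\pm1}]$. The symbol $\doteq$ means equality up to multiplication by units $\pm t^i$. A polynomial or rational function $p(t)$ is reciprocal if $p(t^{-1})\doteq p(t)$, and non-reciprocal otherwise. An integral polynomial is one with integer coefficients.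
   Formalization: The companion matrix C of (t−1)f(t) has determinant −1, since (t−1)f(t) has constant coefficient +1, so C never lies in SL₃(ℤ); the formal statement takes C and the representation γ in GL₃(ℤ) instead. *)

theory Defs
  imports
    "HOL-Analysis.Homotopy"
    "HOL-Algebra.Coset"
    "HOL-Algebra.Elementary_Groups"
    "HOL-Library.Poly_Mapping"
    "Jordan_Normal_Form.Determinant"
begin

section \<open>Fundamental groups\<close>

definition path_class :: "'a::topological_space set \<Rightarrow> (real \<Rightarrow> 'a) \<Rightarrow> (real \<Rightarrow> 'a) set" where
  "path_class X g = {g'. homotopic_paths X g g'}"

definition fundamental_group ::
    "'a::topological_space set \<Rightarrow> 'a \<Rightarrow> (real \<Rightarrow> 'a) set monoid" where
  "fundamental_group X p =
    \<lparr>carrier = {path_class X g |g. path g \<and> path_image g \<subseteq> X \<and> pathstart g = p \<and> pathfinish g = p},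
     monoid.mult = (\<lambda>A B. {q. \<exists>a\<in>A. \<exists>b\<in>B. homotopic_paths X (a +++ b) q}),
     one = path_class X (\<lambda>_. p)\<rparr>"

lemma path_class_eqI: "homotopic_paths X g g' \<Longrightarrow> path_class X g = path_class X g'"
  unfolding path_class_def by (auto intro: homotopic_paths_trans homotopic_paths_sym)

lemma fundamental_group_mult:
  assumes "path g" "path_image g \<subseteq> X" "path g'" "path_image g' \<subseteq> X" "pathfinish g = pathstart g'"
  shows "path_class X g \<otimes>\<^bsub>fundamental_group X p\<^esub> path_class X g' = path_class X (g +++ g')"
proof -
  have 1: "homotopic_paths X (a +++ b) q \<longleftrightarrow> homotopic_paths X (g +++ g') q"
    if "homotopic_paths X g a" "homotopic_paths X g' b" for a b q
    using homotopic_paths_join[OF that assms(5)]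
    by (meson homotopic_paths_sym homotopic_paths_trans)
  have 2: "homotopic_paths X g g" "homotopic_paths X g' g'"
    using assms by simp_all
  have "(\<exists>a\<in>path_class X g. \<exists>b\<in>path_class X g'. homotopic_paths X (a +++ b) q) \<longleftrightarrow>
      homotopic_paths X (g +++ g') q" for q
    unfolding path_class_def mem_Collect_eq Bex_def using 1 2 by blast
  then show ?thesis
    by (simp add: fundamental_group_def) (simp add: path_class_def)
qed

lemma group_fundamental_group:
  fixes X :: "'a::real_normed_vector set"
  assumes "p \<in> X"
  shows "group (fundamental_group X p)"
proof -
  let ?G = "fundamental_group X p"
  define L where "L = {g. path g \<and> path_image g \<subseteq> X \<and> pathstart g = p \<and> pathfinish g = p}"
  have car: "carrier ?G = path_class X ` L"
    unfolding fundamental_group_def L_def by auto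
  have const: "linepath p p = (\<lambda>_. p)" by (rule linepath_refl)
  have constL: "linepath p p \<in> L" using assms by (simp add: L_def)
  have one: "\<one>\<^bsub>?G\<^esub> = path_class X (linepath p p)"
    unfolding const by (simp add: fundamental_group_def)
  have mult: "path_class X g \<otimes>\<^bsub>?G\<^esub> path_class X g' = path_class X (g +++ g')"
    if "g \<in> L" "g' \<in> L" for g g'
    using that unfolding L_def by (intro fundamental_group_mult) auto
  have closed: "g +++ g' \<in> L" "reversepath g \<in> L" if "g \<in> L" "g' \<in> L" for g g'
    using that unfolding L_def by (auto simp: path_image_join)
  show ?thesis
  proof (rule groupI)
    show "\<one>\<^bsub>?G\<^esub> \<in> carrier ?G" using constL one car by auto
  next
    fix A B assume "A \<in> carrier ?G" "B \<in> carrier ?G"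
    then show "A \<otimes>\<^bsub>?G\<^esub> B \<in> carrier ?G"
      using closed(1) by (auto simp: car mult)
  next
    fix A B C assume "A \<in> carrier ?G" "B \<in> carrier ?G" "C \<in> carrier ?G"
    then obtain a b c where abc: "a \<in> L" "b \<in> L" "c \<in> L"
      "A = path_class X a" "B = path_class X b" "C = path_class X c"
      by (auto simp: car)
    have "homotopic_paths X (a +++ (b +++ c)) ((a +++ b) +++ c)"
      using abc unfolding L_def by (intro homotopic_paths_assoc) auto
    from path_class_eqI[OF this] show "A \<otimes>\<^bsub>?G\<^esub> B \<otimes>\<^bsub>?G\<^esub> C = A \<otimes>\<^bsub>?G\<^esub> (B \<otimes>\<^bsub>?G\<^esub> C)"
      using abc by (simp add: mult closed(1))
  next
    fix A assume "A \<in> carrier ?G"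
    then obtain a where a: "a \<in> L" "A = path_class X a" by (auto simp: car)
    have "homotopic_paths X (linepath p p +++ a) a"
      using a unfolding L_def by (intro homotopic_paths_lid') auto
    from path_class_eqI[OF this] show "\<one>\<^bsub>?G\<^esub> \<otimes>\<^bsub>?G\<^esub> A = A"
      using a constL by (simp add: one mult)
    have "homotopic_paths X (reversepath a +++ a) (linepath p p)"
      using a homotopic_paths_linv[of a X] unfolding L_def by auto
    from path_class_eqI[OF this] have "path_class X (reversepath a) \<otimes>\<^bsub>?G\<^esub> A = \<one>\<^bsub>?G\<^esub>"
      using a closed(2)[OF a(1) a(1)] by (simp add: one mult)
    moreover have "path_class X (reversepath a) \<in> carrier ?G"
      using closed(2)[OF a(1) a(1)] by (simp add: car)
    ultimately show "\<exists>B\<in>carrier ?G. B \<otimes>\<^bsub>?G\<^esub> A = \<one>\<^bsub>?G\<^esub>" by blast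
  qed
qed


section \<open>Free groups, presentations and Fox derivatives\<close>

text \<open>The letter \<open>(i, True)\<close> stands for the generator \<open>x\<^sub>i\<close> and \<open>(i, False)\<close> for its inverse;
  elements of the free group are the reduced words.\<close>

type_synonym 'a word = "('a \<times> bool) list"

definition flip :: "'a \<times> bool \<Rightarrow> 'a \<times> bool" where
  "flip l = (fst l, \<not> snd l)"

fun reduced :: "'a word \<Rightarrow> bool" where
  "reduced (l # l' # w) \<longleftrightarrow> l' \<noteq> flip l \<and> reduced (l' # w)"
| "reduced _ \<longleftrightarrow> True"

fun push :: "'a \<times> bool \<Rightarrow> 'a word \<Rightarrow> 'a word" where
  "push l [] = [l]"
| "push l (l' # w) = (if l' = flip l then w else l # l' # w)"

definition free_group :: "'a set \<Rightarrow> 'a word monoid" where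
  "free_group S = \<lparr>carrier = {w. reduced w \<and> fst ` set w \<subseteq> S}, monoid.mult = foldr push, one = []\<rparr>"

lemma flip_flip [simp]: "flip (flip l) = l"
  and fst_flip [simp]: "fst (flip l) = fst l"
  by (auto simp: flip_def)

lemma reduced_ConsD: "reduced (l # w) \<Longrightarrow> reduced w"
  by (cases w) auto

lemma push_reduced: "reduced w \<Longrightarrow> reduced (l # w) \<Longrightarrow> push l w = l # w"
  by (cases w) auto

lemma reduced_push: "reduced w \<Longrightarrow> reduced (push l w)"
  by (cases w) (auto dest: reduced_ConsD)

lemma push_flip: "reduced w \<Longrightarrow> push l (push (flip l) w) = w"
  by (cases w; cases "tl w") auto

lemma reduced_foldr_push: "reduced v \<Longrightarrow> reduced (foldr push u v)"
  by (induction u) (auto intro: reduced_push)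

lemma foldr_push_Nil: "reduced u \<Longrightarrow> foldr push u [] = u"
proof (induction u)
  case (Cons l u)
  then show ?case using reduced_ConsD[of l u] push_reduced[of u l] by simp
qed simp

lemma foldr_push_push:
  "reduced v \<Longrightarrow> foldr push (push l u) v = push l (foldr push u v)"
  by (cases u) (auto simp: push_flip reduced_foldr_push)

lemma foldr_push_assoc:
  "reduced w \<Longrightarrow> foldr push (foldr push u v) w = foldr push u (foldr push v w)"
  by (induction u) (auto simp: foldr_push_push)

lemma set_push: "set (push l w) \<subseteq> insert l (set w)"
  by (cases w) auto

lemma set_foldr_push: "set (foldr push u v) \<subseteq> set u \<union> set v"
  using set_push by (induction u) fastforce+

lemma group_free_group: "group (free_group S)"
proof (rule groupI)
  fix u assume u: "u \<in> carrier (free_group S)"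
  define u' where "u' = foldr push (rev (map flip u)) []"
  have "foldr push (rev (map flip u)) u = []"
    by (induction u) auto
  moreover have "fst ` set u' \<subseteq> S"
  proof -
    have "fst ` set u' \<subseteq> fst ` flip ` set u"
      using set_foldr_push[of "rev (map flip u)" "[]"] unfolding u'_def by (intro image_mono) simp
    also have "\<dots> = fst ` set u" by (simp add: image_image)
    finally show ?thesis using u by (auto simp: free_group_def)
  qed
  ultimately show "\<exists>v\<in>carrier (free_group S). v \<otimes>\<^bsub>free_group S\<^esub> u = \<one>\<^bsub>free_group S\<^esub>"
    using u by (intro bexI[of _ u'])
      (auto simp: free_group_def u'_def foldr_push_assoc reduced_foldr_push)
next
  fix u v assume "u \<in> carrier (free_group S)" "v \<in> carrier (free_group S)"
  then show "u \<otimes>\<^bsub>free_group S\<^esub> v \<in> carrier (free_group S)"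
    using set_foldr_push[of u v] by (fastforce simp: free_group_def reduced_foldr_push)
qed (auto simp: free_group_def foldr_push_assoc)

text \<open>The homomorphism from the free group to \<open>G\<close> with \<open>x\<^sub>i \<mapsto> x i\<close>.\<close>

definition word_eval :: "('g, 'b) monoid_scheme \<Rightarrow> ('a \<Rightarrow> 'g) \<Rightarrow> 'a word \<Rightarrow> 'g" where
  "word_eval G x w =
    foldr (\<lambda>l g. (if snd l then x (fst l) else inv\<^bsub>G\<^esub> x (fst l)) \<otimes>\<^bsub>G\<^esub> g) w \<one>\<^bsub>G\<^esub>"

definition normal_closure :: "('g, 'b) monoid_scheme \<Rightarrow> 'g set \<Rightarrow> 'g set" where
  "normal_closure G R = \<Inter>{N. N \<lhd> G \<and> R \<subseteq> N}"

definition is_presentation ::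
    "('g, 'b) monoid_scheme \<Rightarrow> 'a set \<Rightarrow> ('a \<Rightarrow> 'g) \<Rightarrow> 'a word set \<Rightarrow> bool" where
  "is_presentation G S x R \<longleftrightarrow>
    group G \<and> x \<in> S \<rightarrow> carrier G \<and> R \<subseteq> carrier (free_group S) \<and>
    word_eval G x ` carrier (free_group S) = carrier G \<and>
    kernel (free_group S) G (word_eval G x) = normal_closure (free_group S) R"

text \<open>Elements of an integral group ring are finitely supported functions; \<open>translate G g a\<close> is
  the product \<open>g a\<close> of a group element and a group ring element.\<close>

definition translate ::
    "('g, 'b) monoid_scheme \<Rightarrow> 'g \<Rightarrow> ('g \<Rightarrow>\<^sub>0 int) \<Rightarrow> ('g \<Rightarrow>\<^sub>0 int)" where
  "translate G g a = (\<Sum>u\<in>Poly_Mapping.keys a. Poly_Mapping.single (g \<otimes>\<^bsub>G\<^esub> u) (Poly_Mapping.lookup a u))"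

definition fox_letter :: "'a \<Rightarrow> 'a \<times> bool \<Rightarrow> ('a word \<Rightarrow>\<^sub>0 int)" where
  "fox_letter j l =
    (if fst l \<noteq> j then 0
     else if snd l then Poly_Mapping.single [] 1
     else - Poly_Mapping.single [l] 1)"

text \<open>The Fox derivative with respect to \<open>x\<^sub>j\<close>, computed letter by letter with
  \<open>\<partial>(uv) = \<partial>u + u \<partial>v\<close>; see \<open>fox_mult\<close> below for this rule in the free group.\<close>

primrec fox :: "'a \<Rightarrow> 'a word \<Rightarrow> ('a word \<Rightarrow>\<^sub>0 int)" where
  "fox j [] = 0"
| "fox j (l # w) = fox_letter j l + translate (free_group UNIV) [l] (fox j w)"

lemma translate_superset:
  assumes "finite A" "Poly_Mapping.keys a \<subseteq> A"
  shows "translate G g a = (\<Sum>u\<in>A. Poly_Mapping.single (g \<otimes>\<^bsub>G\<^esub> u) (Poly_Mapping.lookup a u))"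
  unfolding translate_def using assms
  by (intro sum.mono_neutral_left) (auto simp: in_keys_iff)

lemma translate_0 [simp]: "translate G g 0 = 0"
  by (simp add: translate_def)

lemma translate_add: "translate G g (a + b) = translate G g a + translate G g b"
proof -
  let ?A = "Poly_Mapping.keys a \<union> Poly_Mapping.keys b"
  have "translate G g c = (\<Sum>u\<in>?A. Poly_Mapping.single (g \<otimes>\<^bsub>G\<^esub> u) (Poly_Mapping.lookup c u))"
    if "c \<in> {a, b, a + b}" for c
    using that Poly_Mapping.keys_add[of a b] by (intro translate_superset) auto
  then show ?thesis
    by (simp add: lookup_add single_add sum.distrib)
qed

lemma translate_single [simp]:
  "translate G g (Poly_Mapping.single u c) = Poly_Mapping.single (g \<otimes>\<^bsub>G\<^esub> u) c"
  by (auto simp: translate_def)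

lemma translate_uminus: "translate G g (- a) = - translate G g a"
  using translate_add[of G g a "- a"] by (simp add: eq_neg_iff_add_eq_0 add.commute)

lemma translate_sum: "translate G g (\<Sum>i\<in>I. a i) = (\<Sum>i\<in>I. translate G g (a i))"
  by (induction I rule: infinite_finite_induct) (auto simp: translate_add)

lemma translate_one:
  assumes "group G" "Poly_Mapping.keys a \<subseteq> carrier G"
  shows "translate G \<one>\<^bsub>G\<^esub> a = a"
proof -
  interpret group G by fact
  have "translate G \<one>\<^bsub>G\<^esub> a =
      (\<Sum>u\<in>Poly_Mapping.keys a. Poly_Mapping.single u (Poly_Mapping.lookup a u))"
    unfolding translate_def using assms by (intro sum.cong) auto
  then show ?thesis
    by (auto intro!: poly_mapping_eqI
        simp: lookup_sum lookup_single when_def in_keys_iff sum.delta)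
qed

lemma translate_mult:
  assumes "group G" "Poly_Mapping.keys a \<subseteq> carrier G" "g \<in> carrier G" "h \<in> carrier G"
  shows "translate G g (translate G h a) = translate G (g \<otimes>\<^bsub>G\<^esub> h) a"
proof -
  interpret group G by fact
  show ?thesis
    unfolding translate_def[of G h] translate_sum unfolding translate_def[of G "g \<otimes>\<^bsub>G\<^esub> h"] translate_single
    using assms by (intro sum.cong) (auto simp: m_assoc)
qed

lemma translate_free_group:
  assumes "reduced u" "reduced v" "\<forall>w\<in>Poly_Mapping.keys a. reduced w"
  shows "translate (free_group UNIV) u (translate (free_group UNIV) v a) =
    translate (free_group UNIV) (foldr push u v) a"
  using translate_mult[OF group_free_group, of a UNIV u v] assms
  by (auto simp: free_group_def)

lemma reduced_keys_fox: "\<forall>w\<in>Poly_Mapping.keys (fox j u). reduced w"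
proof (induction u)
  case (Cons l u)
  have "Poly_Mapping.keys (translate (free_group UNIV) [l] (fox j u)) \<subseteq> {w. reduced w}"
    unfolding translate_def
    using Cons by (intro order.trans[OF keys_sum])
      (auto simp: free_group_def reduced_push)
  moreover have "Poly_Mapping.keys (fox_letter j l) \<subseteq> {w. reduced w}"
    by (auto simp: fox_letter_def)
  ultimately show ?case
    using Poly_Mapping.keys_add[of "fox_letter j l"] by fastforce
qed simp

lemma fox_push:
  assumes "reduced w"
  shows "fox j (push l w) = fox_letter j l + translate (free_group UNIV) [l] (fox j w)"
proof (cases w)
  case (Cons l' w')
  show ?thesis
  proof (cases "l' = flip l")
    case True
    have "fox_letter j l + translate (free_group UNIV) [l] (fox_letter j (flip l)) = 0"
      by (cases l) (auto simp: fox_letter_def flip_def translate_uminus free_group_def)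
    moreover have "translate (free_group UNIV) [l] (translate (free_group UNIV) [flip l] (fox j w'))
        = fox j w'"
      using translate_free_group[of "[l]" "[flip l]" "fox j w'"] reduced_keys_fox[of j w']
        translate_one[OF group_free_group, of "fox j w'" UNIV]
      by (auto simp: free_group_def)
    ultimately show ?thesis
      by (simp add: Cons True translate_add flip: add.assoc)
  qed (simp add: Cons)
qed simp

lemma fox_mult:
  assumes "u \<in> carrier (free_group S)" "v \<in> carrier (free_group S)"
  shows "fox j (u \<otimes>\<^bsub>free_group S\<^esub> v) = fox j u + translate (free_group S) u (fox j v)"
proof -
  have v: "reduced v" and u: "reduced u" using assms by (auto simp: free_group_def)
  have S: "translate (free_group S) = translate (free_group UNIV)"
    by (simp add: fun_eq_iff translate_def free_group_def)
  have "fox j (foldr push u v) = fox j u + translate (free_group UNIV) u (fox j v)"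
    using u
  proof (induction u)
    case Nil
    have "Poly_Mapping.keys (fox j v) \<subseteq> carrier (free_group UNIV)"
      using reduced_keys_fox[of j v] by (auto simp: free_group_def)
    from translate_one[OF group_free_group this] show ?case
      by (simp add: free_group_def)
  next
    case (Cons l u)
    then have red: "reduced u" by (auto dest: reduced_ConsD)
    have "translate (free_group UNIV) [l] (translate (free_group UNIV) u (fox j v)) =
        translate (free_group UNIV) (l # u) (fox j v)"
      using translate_free_group[of "[l]" u "fox j v"] reduced_keys_fox[of j v] red
        push_reduced[of u l] Cons.prems by simp
    then show ?case
      using Cons red v by (simp add: fox_push reduced_foldr_push translate_add add.assoc)
  qed
  then show ?thesis by (simp add: S) (simp add: free_group_def)
qed


section \<open>Knots in the 3-sphere and Wirtinger presentations\<close>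

text \<open>The 3-sphere is the unit sphere of \<open>\<complex>\<^sup>2\<close>. A tame knot is given together with a tubular
  neighbourhood, parametrised by an embedding \<open>\<nu>\<close> of \<open>S\<^sup>1 \<times> \<complex>\<close> with core \<open>K\<close>; the exterior is the
  complement of the open solid torus \<open>\<nu>(S\<^sup>1 \<times> {|z| < 1})\<close>. Embedding all of \<open>S\<^sup>1 \<times> \<complex>\<close> makes the
  boundary torus bicollared.\<close>

definition tubular_neighbourhood ::
    "(complex \<times> complex) set \<Rightarrow> (complex \<times> complex \<Rightarrow> complex \<times> complex) \<Rightarrow> bool" where
  "tubular_neighbourhood K \<nu> \<longleftrightarrow>
    \<nu> ` (sphere 0 1 \<times> UNIV) \<subseteq> sphere 0 1 \<and>
    (\<exists>g. homeomorphism (sphere 0 1 \<times> UNIV) (\<nu> ` (sphere 0 1 \<times> UNIV)) \<nu> g) \<and>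
    \<nu> ` (sphere 0 1 \<times> {0}) = K"

definition exterior :: "(complex \<times> complex \<Rightarrow> complex \<times> complex) \<Rightarrow> (complex \<times> complex) set" where
  "exterior \<nu> = sphere 0 1 - \<nu> ` (sphere 0 1 \<times> ball 0 1)"

definition meridian_loop :: "(complex \<times> complex \<Rightarrow> complex \<times> complex) \<Rightarrow> real \<Rightarrow> complex \<times> complex" where
  "meridian_loop \<nu> s = \<nu> (1, cis (2 * pi * s))"

definition is_meridian ::
    "(complex \<times> complex \<Rightarrow> complex \<times> complex) \<Rightarrow> complex \<times> complex \<Rightarrow>
      (real \<Rightarrow> complex \<times> complex) set \<Rightarrow> bool" where
  "is_meridian \<nu> p g \<longleftrightarrow>
    (\<exists>q. path q \<and> path_image q \<subseteq> exterior \<nu> \<and> pathstart q = p \<and> pathfinish q = \<nu> (1, 1) \<and>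
      g = path_class (exterior \<nu>) (q +++ (meridian_loop \<nu> +++ reversepath q)))"

text \<open>The relator of a crossing: the loops around the two under-arcs are conjugate by the loop
  around the over-arc, or by its inverse, according to the sign of the crossing.\<close>

definition wirtinger_relator :: "'a set \<Rightarrow> 'a word \<Rightarrow> bool" where
  "wirtinger_relator S r \<longleftrightarrow>
    (\<exists>a\<in>S. \<exists>b\<in>S. \<exists>c\<in>S. \<exists>e. r = foldr push [(a, e), (b, True), (a, \<not> e), (c, False)] [])"

definition wirtinger_presentation ::
    "(complex \<times> complex \<Rightarrow> complex \<times> complex) \<Rightarrow> complex \<times> complex \<Rightarrow> nat \<Rightarrow>
      (nat \<Rightarrow> (real \<Rightarrow> complex \<times> complex) set) \<Rightarrow> (nat \<Rightarrow> nat word) \<Rightarrow> bool" where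
  "wirtinger_presentation \<nu> p m x r \<longleftrightarrow>
    is_presentation (fundamental_group (exterior \<nu>) p) {0..m} x (r ` {1..m}) \<and>
    (\<forall>j\<in>{0..m}. is_meridian \<nu> p (x j)) \<and>
    (\<forall>i\<in>{1..m}. wirtinger_relator {0..m} (r i))"


section \<open>The field of rational functions\<close>

definition tvar :: "complex poly fract" where
  "tvar = to_fract [:0, 1:]"

definition const :: "complex \<Rightarrow> complex poly fract" where
  "const c = to_fract [:c:]"

definition eval_int_poly :: "int poly \<Rightarrow> 'a::comm_ring_1 \<Rightarrow> 'a" where
  "eval_int_poly q s = poly (map_poly of_int q) s"

definition eq_unit :: "complex poly fract \<Rightarrow> complex poly fract \<Rightarrow> bool" (infix "\<doteq>" 50) where
  "p \<doteq> q \<longleftrightarrow> (\<exists>k::int. p = tvar powi k * q \<or> p = - (tvar powi k * q))"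

definition reciprocal :: "int poly \<Rightarrow> bool" where
  "reciprocal q \<longleftrightarrow> eval_int_poly q (inverse tvar) \<doteq> eval_int_poly q tvar"


section \<open>Reidemeister torsion\<close>

text \<open>A based chain complex \<open>C\<^sub>N \<rightarrow> \<dots> \<rightarrow> C\<^sub>0\<close> over a field: \<open>C\<^sub>i\<close> consists of the row vectors of
  length \<open>c i\<close>, and the boundary map \<open>C\<^sub>i \<rightarrow> C\<^sub>i\<^sub>-\<^sub>1\<close> is right multiplication by \<open>d i\<close>.\<close>

definition is_chain_complex :: "nat \<Rightarrow> (nat \<Rightarrow> nat) \<Rightarrow> (nat \<Rightarrow> 'k::field mat) \<Rightarrow> bool" where
  "is_chain_complex N c d \<longleftrightarrow>
    (\<forall>i\<in>{1..N}. d i \<in> carrier_mat (c i) (c (i - 1))) \<and>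
    (\<forall>i\<in>{2..N}. d i * d (i - 1) = 0\<^sub>m (c i) (c (i - 2)))"

text \<open>The vectors \<open>\<partial>b\<^sub>i\<^sub>+\<^sub>1\<close> followed by \<open>b\<^sub>i\<close>, as the rows of a matrix.\<close>

definition basis_mat ::
    "(nat \<Rightarrow> nat) \<Rightarrow> (nat \<Rightarrow> 'k::field mat) \<Rightarrow> (nat \<Rightarrow> 'k vec list) \<Rightarrow> nat \<Rightarrow> 'k mat" where
  "basis_mat c d b i =
    mat_of_rows (c i) (map (\<lambda>v. transpose_mat (d (Suc i)) *\<^sub>v v) (b (Suc i)) @ b i)"

text \<open>For an acyclic complex, \<open>\<partial>b\<^sub>i\<^sub>+\<^sub>1\<close> is a basis of the boundaries in \<open>C\<^sub>i\<close> and \<open>b\<^sub>i\<close> lifts a basis of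
  the boundaries in \<open>C\<^sub>i\<^sub>-\<^sub>1\<close>; such \<open>b\<close> exist exactly when the complex is acyclic. The convention is
  \<open>\<tau> = \<Prod>\<^sub>i [\<partial>b\<^sub>i\<^sub>+\<^sub>1, b\<^sub>i / c\<^sub>i]\<close> with exponents \<open>(-1)\<^sup>i\<^sup>+\<^sup>1\<close>. It does not depend on \<open>b\<close>.\<close>

definition is_torsion :: "nat \<Rightarrow> (nat \<Rightarrow> nat) \<Rightarrow> (nat \<Rightarrow> 'k::field mat) \<Rightarrow> 'k \<Rightarrow> bool" where
  "is_torsion N c d \<tau> \<longleftrightarrow> is_chain_complex N c d \<and>
    (\<exists>b. b 0 = [] \<and> b (Suc N) = [] \<and>
      (\<forall>i\<in>{0..N}. set (b i) \<subseteq> carrier_vec (c i) \<and>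
        length (b (Suc i)) + length (b i) = c i \<and> det (basis_mat c d b i) \<noteq> 0) \<and>
      \<tau> = (\<Prod>i=0..N. det (basis_mat c d b i) powi ((- 1) ^ Suc i)))"

text \<open>The torsion of a complex that is not acyclic is \<open>0\<close> by convention.\<close>

definition reidemeister_torsion :: "nat \<Rightarrow> (nat \<Rightarrow> nat) \<Rightarrow> (nat \<Rightarrow> 'k::field mat) \<Rightarrow> 'k" where
  "reidemeister_torsion N c d =
    (if \<exists>\<tau>. is_torsion N c d \<tau> then THE \<tau>. is_torsion N c d \<tau> else 0)"


section \<open>Twisted chain complex, torsion and Alexander polynomial\<close>

text \<open>The linear extension to \<open>\<int>[\<pi>]\<close> of \<open>g \<mapsto> t\<^bsup>\<epsilon>(g)\<^esup> \<gamma>(g)\<close>, with entries in \<open>\<complex>(t)\<close>.\<close>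

definition Phi ::
    "nat \<Rightarrow> ('g \<Rightarrow> int) \<Rightarrow> ('g \<Rightarrow> complex mat) \<Rightarrow> ('g \<Rightarrow>\<^sub>0 int) \<Rightarrow> complex poly fract mat" where
  "Phi n \<epsilon> \<gamma> a = mat n n (\<lambda>(k, l). \<Sum>g\<in>Poly_Mapping.keys a.
     of_int (Poly_Mapping.lookup a g) * (tvar powi \<epsilon> g * const (\<gamma> g $$ (k, l))))"

text \<open>\<open>Phi\<close> on the group ring of the free group, via the projection \<open>x\<^sub>j \<mapsto> x j\<close> to \<open>G\<close>.\<close>

definition Phi_free ::
    "('g, 'b) monoid_scheme \<Rightarrow> (nat \<Rightarrow> 'g) \<Rightarrow> nat \<Rightarrow> ('g \<Rightarrow> int) \<Rightarrow> ('g \<Rightarrow> complex mat) \<Rightarrow>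
      (nat word \<Rightarrow>\<^sub>0 int) \<Rightarrow> complex poly fract mat" where
  "Phi_free G x n \<epsilon> \<gamma> = Phi n (\<lambda>w. \<epsilon> (word_eval G x w)) (\<lambda>w. \<gamma> (word_eval G x w))"

definition block_mat :: "nat \<Rightarrow> nat \<Rightarrow> nat \<Rightarrow> (nat \<Rightarrow> nat \<Rightarrow> 'k mat) \<Rightarrow> 'k mat" where
  "block_mat n a b B = mat (a * n) (b * n) (\<lambda>(k, l). B (k div n) (l div n) $$ (k mod n, l mod n))"

definition fox_mat ::
    "('g, 'b) monoid_scheme \<Rightarrow> nat \<Rightarrow> (nat \<Rightarrow> 'g) \<Rightarrow> (nat \<Rightarrow> nat word) \<Rightarrow>
      nat \<Rightarrow> ('g \<Rightarrow> int) \<Rightarrow> ('g \<Rightarrow> complex mat) \<Rightarrow> complex poly fract mat" where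
  "fox_mat G m x r n \<epsilon> \<gamma> =
    block_mat n m (Suc m) (\<lambda>i j. Phi_free G x n \<epsilon> \<gamma> (fox j (r (Suc i))))"

text \<open>The matrix obtained from \<open>fox_mat\<close> by deleting the block column of \<open>x\<^sub>0\<close>.\<close>

definition fox_mat0 ::
    "('g, 'b) monoid_scheme \<Rightarrow> nat \<Rightarrow> (nat \<Rightarrow> 'g) \<Rightarrow> (nat \<Rightarrow> nat word) \<Rightarrow>
      nat \<Rightarrow> ('g \<Rightarrow> int) \<Rightarrow> ('g \<Rightarrow> complex mat) \<Rightarrow> complex poly fract mat" where
  "fox_mat0 G m x r n \<epsilon> \<gamma> =
    block_mat n m m (\<lambda>i j. Phi_free G x n \<epsilon> \<gamma> (fox (Suc j) (r (Suc i))))"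

text \<open>The twisted chain complex \<open>(\<complex>(t) \<otimes> \<complex>\<^sup>n) \<otimes>\<^sub>\<gamma> C\<^sub>*\<close> of the universal cover, for the cell structure
  given by the Wirtinger presentation: one 0-cell, a 1-cell for each \<open>x\<^sub>j\<close> and a 2-cell for each \<open>r\<^sub>i\<close>, with
  \<open>\<partial>x\<^sub>j = x\<^sub>j - 1\<close> and \<open>\<partial>r\<^sub>i = \<Sum>\<^sub>j (\<partial>r\<^sub>i/\<partial>x\<^sub>j) x\<^sub>j\<close> over the group ring of \<open>G\<close>.\<close>

definition twisted_dim :: "nat \<Rightarrow> nat \<Rightarrow> nat \<Rightarrow> nat" where
  "twisted_dim m n i = [1, Suc m, m] ! i * n"

definition twisted_boundary ::
    "('g, 'b) monoid_scheme \<Rightarrow> nat \<Rightarrow> (nat \<Rightarrow> 'g) \<Rightarrow> (nat \<Rightarrow> nat word) \<Rightarrow>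
      nat \<Rightarrow> ('g \<Rightarrow> int) \<Rightarrow> ('g \<Rightarrow> complex mat) \<Rightarrow> nat \<Rightarrow> complex poly fract mat" where
  "twisted_boundary G m x r n \<epsilon> \<gamma> i =
    (if i = 2 then fox_mat G m x r n \<epsilon> \<gamma>
     else block_mat n (Suc m) 1 (\<lambda>j _. Phi_free G x n \<epsilon> \<gamma>
       (Poly_Mapping.single [(j, True)] 1 - Poly_Mapping.single [] 1)))"

definition twisted_torsion ::
    "('g, 'b) monoid_scheme \<Rightarrow> nat \<Rightarrow> (nat \<Rightarrow> 'g) \<Rightarrow> (nat \<Rightarrow> nat word) \<Rightarrow>
      nat \<Rightarrow> ('g \<Rightarrow> int) \<Rightarrow> ('g \<Rightarrow> complex mat) \<Rightarrow> complex poly fract" where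
  "twisted_torsion G m x r n \<epsilon> \<gamma> =
    reidemeister_torsion 2 (twisted_dim m n) (twisted_boundary G m x r n \<epsilon> \<gamma>)"

definition alexander_polynomial ::
    "('g, 'b) monoid_scheme \<Rightarrow> nat \<Rightarrow> (nat \<Rightarrow> 'g) \<Rightarrow> (nat \<Rightarrow> nat word) \<Rightarrow> ('g \<Rightarrow> int) \<Rightarrow>
      complex poly fract" where
  "alexander_polynomial G m x r \<epsilon> = det (fox_mat0 G m x r 1 \<epsilon> (\<lambda>_. 1\<^sub>m 1))"

text \<open>The companion matrix of a monic polynomial.\<close>

definition companion :: "'a::comm_ring_1 poly \<Rightarrow> 'a mat" where
  "companion q = mat (degree q) (degree q)
    (\<lambda>(i, j). if Suc j = degree q then - coeff q i else if i = Suc j then 1 else 0)"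

text \<open>For a quadratic \<open>f\<close> with constant coefficient \<open>-1\<close>, the companion matrix of \<open>(t - 1) f(t)\<close> has
  determinant \<open>-1\<close>, so cyclic representations with this value live in \<open>GL\<^sub>3(\<int>)\<close>.\<close>

definition GL_int :: "nat \<Rightarrow> int mat monoid" where
  "GL_int n = units_of (ring_mat TYPE(int) n ())"

end

theory Submission
  imports Defs
begin

text \<open>Every \<open>x\<^sub>j\<close> acts by the same matrix \<open>C\<close>, so each block of the Fox matrix is a Laurent
  polynomial in \<open>t C\<close>. The companion matrix \<open>C\<close> has the eigenvalues \<open>1\<close>, \<open>\<alpha>\<close> and \<open>\<beta>\<close>, where
  \<open>\<alpha>\<close> and \<open>\<beta> = -1/\<alpha>\<close> are the roots of \<open>f\<close>. Diagonalising it turns the Wada invariant into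
  \<open>\<Delta>(t) \<Delta>(\<alpha>t) \<Delta>(\<beta>t) / ((t - 1) (\<alpha>t - 1) (\<beta>t - 1))\<close>. Substituting \<open>\<Delta>(t) = f(t) f(1/t)\<close> and
  using \<open>\<alpha>\<beta> = -1\<close> and \<open>\<alpha>\<^sup>2 + \<beta>\<^sup>2 = 3\<close>, the denominator cancels and there remains, up to units,
  \<open>(t - 1) (t + 1)\<^sup>2 f(t) (t\<^sup>2 + 3t + 1) (t\<^sup>2 - 3t + 1)\<close>. All factors other than \<open>f\<close> are
  reciprocal, hence the product is not.\<close>

unbundle no inner_syntax and no vec_syntax


section \<open>Fox derivatives and the exponent sum\<close>

definition letter_exp :: "'a \<times> bool \<Rightarrow> int" where
  "letter_exp l = (if snd l then 1 else -1)"

text \<open>The degree of a word in the abelianization. As \<epsilon> sends every \<open>x j\<close>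
  to 1, it is also the power of t by which the word acts.\<close>

definition exponent_sum :: "'a word \<Rightarrow> int" where
  "exponent_sum w = sum_list (map letter_exp w)"

lemma exponent_sum_simps [simp]:
  "exponent_sum [] = 0"
  "exponent_sum (l # w) = letter_exp l + exponent_sum w"
  by (simp_all add: exponent_sum_def)

lemma letter_exp_flip [simp]: "letter_exp (flip l) = - letter_exp l"
  by (simp add: letter_exp_def flip_def)

lemma exponent_sum_push [simp]: "exponent_sum (push l w) = letter_exp l + exponent_sum w"
  by (cases w) auto

lemma exponent_sum_foldr_push [simp]:
  "exponent_sum (foldr push u v) = exponent_sum u + exponent_sum v"
  by (induction u) auto

text \<open>The two letters a have opposite signs, and so do b and c. Free reduction preserves the
  sum, so \<open>foldr push\<close> stays unexpanded and only additivity is used.\<close>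

lemma exponent_sum_wirtinger_relator: "wirtinger_relator S r \<Longrightarrow> exponent_sum r = 0"
  unfolding wirtinger_relator_def
  by (elim bexE exE) (simp del: foldr.simps push.simps add: letter_exp_def)

text \<open>The image of a group ring element of the free group under \<open>x\<^sub>j \<mapsto> s\<close>, for every \<open>j\<close>.\<close>

definition laurent :: "('a word \<Rightarrow>\<^sub>0 int) \<Rightarrow> 'k::field \<Rightarrow> 'k" where
  "laurent a s = (\<Sum>w\<in>Poly_Mapping.keys a. of_int (Poly_Mapping.lookup a w) * s powi exponent_sum w)"

lemma laurent_superset:
  assumes "finite A" "Poly_Mapping.keys a \<subseteq> A"
  shows "laurent a s = (\<Sum>w\<in>A. of_int (Poly_Mapping.lookup a w) * s powi exponent_sum w)"
  unfolding laurent_def using assms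
  by (intro sum.mono_neutral_left) (auto simp: in_keys_iff)

lemma laurent_0 [simp]: "laurent 0 s = 0"
  by (simp add: laurent_def)

lemma laurent_add: "laurent (a + b) s = laurent a s + laurent b s"
proof -
  let ?A = "Poly_Mapping.keys a \<union> Poly_Mapping.keys b"
  have "laurent c s = (\<Sum>w\<in>?A. of_int (Poly_Mapping.lookup c w) * s powi exponent_sum w)"
    if "c \<in> {a, b, a + b}" for c
    using that Poly_Mapping.keys_add[of a b] by (intro laurent_superset) auto
  then show ?thesis
    by (simp add: lookup_add sum.distrib algebra_simps)
qed

lemma laurent_single [simp]:
  "laurent (Poly_Mapping.single w c) s = of_int c * s powi exponent_sum w"
  by (auto simp: laurent_def)

lemma laurent_uminus: "laurent (- a) s = - laurent a s"
  using laurent_add[of a "- a" s] by (simp add: eq_neg_iff_add_eq_0 add.commute)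

lemma laurent_diff: "laurent (a - b) s = laurent a s - laurent b s"
  using laurent_add[of a "- b" s] by (simp add: laurent_uminus)

lemma laurent_sum: "laurent (\<Sum>i\<in>I. a i) s = (\<Sum>i\<in>I. laurent (a i) s)"
  by (induction I rule: infinite_finite_induct) (auto simp: laurent_add)

text \<open>The exponent sum is additive under reduced multiplication. Invertibility of s gives
  meaning to negative exponents.\<close>

lemma laurent_translate:
  assumes "s \<noteq> 0"
  shows "laurent (translate (free_group S) u a) s = s powi exponent_sum u * laurent a s"
  unfolding translate_def laurent_sum using assms
  by (simp add: free_group_def laurent_def[of a] sum_distrib_left power_int_add mult_ac)

text \<open>The fundamental formula w - 1 = sum of (dw/dx_j)(x_j - 1) after x_j -> s, where all
  factors x_j - 1 become s - 1. The induction follows uv - 1 = (u - 1) + u (v - 1).\<close>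

lemma fox_fundamental_formula:
  assumes "s \<noteq> 0" "finite J" "fst ` set w \<subseteq> J"
  shows "(\<Sum>j\<in>J. laurent (fox j w) s) * (s - 1) = s powi exponent_sum w - 1"
  using assms(3)
proof (induction w)
  case (Cons l w)
  let ?q = "s powi letter_exp l"
  \<comment> \<open>For an inverse letter this is -s^(-1) (s - 1) = s^(-1) - 1.\<close>
  have letter: "laurent (fox_letter j l) s * (s - 1) = (if j = fst l then ?q - 1 else 0)" for j
    using \<open>s \<noteq> 0\<close> by (simp add: fox_letter_def letter_exp_def laurent_uminus power_int_minus right_diff_distrib)
  have "(\<Sum>j\<in>J. laurent (fox j (l # w)) s) =
      (\<Sum>j\<in>J. laurent (fox_letter j l) s) + ?q * (\<Sum>j\<in>J. laurent (fox j w) s)"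
    using \<open>s \<noteq> 0\<close> by (simp add: laurent_add laurent_translate sum.distrib sum_distrib_left)
  moreover have "(\<Sum>j\<in>J. laurent (fox_letter j l) s) * (s - 1) = ?q - 1"
    unfolding sum_distrib_right letter using Cons.prems assms(2) by (subst sum.delta) auto
  moreover have "(\<Sum>j\<in>J. laurent (fox j w) s) * (s - 1) = s powi exponent_sum w - 1"
    using Cons by simp
  ultimately have "(\<Sum>j\<in>J. laurent (fox j (l # w)) s) * (s - 1) =
      ?q - 1 + ?q * (s powi exponent_sum w - 1)"
    by (simp add: distrib_right mult.assoc)
  then show ?case
    using \<open>s \<noteq> 0\<close> by (simp add: power_int_add right_diff_distrib)
qed simp

text \<open>Keeps the derivatives of a relator within the generators of index at most m, the only
  ones whose images in the group are controlled.\<close>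

lemma set_keys_fox: "w \<in> Poly_Mapping.keys (fox j u) \<Longrightarrow> fst ` set w \<subseteq> fst ` set u"
proof (induction u arbitrary: w)
  case (Cons l u)
  have "Poly_Mapping.keys (translate (free_group UNIV) [l] (fox j u)) \<subseteq>
      push l ` Poly_Mapping.keys (fox j u)"
    unfolding translate_def
    by (intro order.trans[OF keys_sum]) (auto simp: free_group_def)
  moreover have "Poly_Mapping.keys (fox_letter j l) \<subseteq> {[], [l]}"
    by (auto simp: fox_letter_def)
  moreover have "w \<in> Poly_Mapping.keys (fox_letter j l) \<union>
      Poly_Mapping.keys (translate (free_group UNIV) [l] (fox j u))"
    using Cons.prems Poly_Mapping.keys_add by fastforce
  ultimately consider "w \<in> {[], [l]}" | v where "v \<in> Poly_Mapping.keys (fox j u)" "w = push l v"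
    by blast
  then show ?case
  proof cases
    case 2
    have "fst ` set w \<subseteq> insert (fst l) (fst ` set v)"
      using image_mono[OF set_push, of fst l v] 2(2) by simp
    then show ?thesis using Cons.IH[OF 2(1)] by auto
  qed auto
qed simp


section \<open>Determinants of block matrices\<close>

text \<open>Writes k = i n + a, which turns a row-by-column sum of a block matrix into a sum over
  blocks and positions.\<close>

lemma sum_div_mod:
  fixes g :: "nat \<Rightarrow> nat \<Rightarrow> 'a::comm_monoid_add"
  shows "(\<Sum>k\<in>{0..<m * n}. g (k div n) (k mod n)) = (\<Sum>i\<in>{0..<m}. \<Sum>a\<in>{0..<n}. g i a)"
proof -
  have "(\<Sum>k\<in>{0..<m * n}. g (k div n) (k mod n)) =
      (\<Sum>i<m. \<Sum>k\<in>{i * n..<i * n + n}. g (k div n) (k mod n))"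
    by (simp add: sum.nat_group atLeast0LessThan)
  also have "\<dots> = (\<Sum>i<m. \<Sum>a\<in>{0..<n}. g i a)"
  proof (rule sum.cong[OF refl])
    fix i
    have "(\<Sum>k\<in>{0 + i * n..<n + i * n}. g (k div n) (k mod n)) =
        (\<Sum>a\<in>{0..<n}. g ((a + i * n) div n) ((a + i * n) mod n))"
      by (rule sum.shift_bounds_nat_ivl)
    also have "\<dots> = (\<Sum>a\<in>{0..<n}. g i a)"
      by (intro sum.cong) auto
    finally show "(\<Sum>k\<in>{i * n..<i * n + n}. g (k div n) (k mod n)) = (\<Sum>a\<in>{0..<n}. g i a)"
      by (simp add: add.commute)
  qed
  finally show ?thesis by (simp add: atLeast0LessThan)
qed

lemma div_less_mult: "k < a * n \<Longrightarrow> k div n < a" for k a n :: nat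
  by (simp add: less_mult_imp_div_less)

lemma mod_less_mult: "k < a * n \<Longrightarrow> k mod n < n" for k a n :: nat
  by (cases "n = 0") auto

lemma block_mat_carrier [simp]: "block_mat n a b B \<in> carrier_mat (a * n) (b * n)"
  by (simp add: block_mat_def)

lemma dim_block_mat [simp]:
  "dim_row (block_mat n a b B) = a * n" "dim_col (block_mat n a b B) = b * n"
  by (simp_all add: block_mat_def)

lemma index_block_mat:
  "k < a * n \<Longrightarrow> l < b * n \<Longrightarrow>
    block_mat n a b B $$ (k, l) = B (k div n) (l div n) $$ (k mod n, l mod n)"
  by (simp add: block_mat_def)

text \<open>Splitting off the last block leaves a two-by-two block matrix with zero off-diagonal
  blocks.\<close>

lemma det_block_diagonal:
  fixes A :: "nat \<Rightarrow> 'k::idom mat"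
  assumes "\<And>c. A c \<in> carrier_mat m m"
  shows "det (block_mat m n n (\<lambda>c c'. if c = c' then A c else 0\<^sub>m m m)) = (\<Prod>c<n. det (A c))"
proof (induction n)
  case 0
  show ?case by (simp add: block_mat_def)
next
  case (Suc n)
  let ?M = "\<lambda>n. block_mat m n n (\<lambda>c c'. if c = c' then A c else 0\<^sub>m m m)"
  have "?M (Suc n) = four_block_mat (?M n) (0\<^sub>m (n * m) m) (0\<^sub>m m (n * m)) (A n)"
  proof (rule eq_matI)
    fix i j
    assume "i < dim_row (four_block_mat (?M n) (0\<^sub>m (n * m) m) (0\<^sub>m m (n * m)) (A n))"
      "j < dim_col (four_block_mat (?M n) (0\<^sub>m (n * m) m) (0\<^sub>m m (n * m)) (A n))"
    then have i: "i < n * m + m" and j: "j < n * m + m"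
      using assms[of n] by (auto simp: block_mat_def)
    \<comment> \<open>Indices from n * m on belong to the last block.\<close>
    have upper: "k div m = n" "k mod m = k - n * m" if "\<not> k < n * m" "k < n * m + m" for k
    proof -
      define l where "l = k - n * m"
      have "k = l + n * m" "l < m"
        using that by (simp_all add: l_def)
      then show "k div m = n" "k mod m = k - n * m" by auto
    qed
    have lower: "k div m < n" "k mod m < m" if "k < n * m" for k
      using that by (rule div_less_mult mod_less_mult)+
    have index: "?M (Suc n) $$ (i, j) =
        (if i div m = j div m then A (i div m) else 0\<^sub>m m m) $$ (i mod m, j mod m)"
      using i j by (simp add: block_mat_def)
    have dim: "dim_row (?M n) = n * m" "dim_col (?M n) = n * m" "dim_row (A n) = m" "dim_col (A n) = m"
      using assms[of n] by (simp_all add: block_mat_def)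
    show "?M (Suc n) $$ (i, j) =
        four_block_mat (?M n) (0\<^sub>m (n * m) m) (0\<^sub>m m (n * m)) (A n) $$ (i, j)"
    proof (cases "i < n * m"; cases "j < n * m")
      assume h: "i < n * m" "j < n * m"
      then show ?thesis
        unfolding index using i j by (subst index_mat_four_block) (simp_all add: dim index_block_mat)
    next
      assume h: "i < n * m" "\<not> j < n * m"
      then show ?thesis
        unfolding index using i j lower[OF h(1)] upper[OF h(2)]
        by (subst index_mat_four_block) (simp_all add: dim)
    next
      assume h: "\<not> i < n * m" "j < n * m"
      then show ?thesis
        unfolding index using i j lower[OF h(2)] upper[OF h(1)]
        by (subst index_mat_four_block) (simp_all add: dim)
    next
      assume h: "\<not> i < n * m" "\<not> j < n * m"
      then show ?thesis
        unfolding index using i j upper[OF h(1)] upper[OF h(2)]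
        by (subst index_mat_four_block) (simp_all add: dim)
    qed
  qed (use assms[of n] in \<open>auto simp: block_mat_def\<close>)
  also have "det \<dots> = det (?M n) * det (A n)"
    by (rule det_four_block_mat_lower_left_zero[OF block_mat_carrier zero_carrier_mat refl assms])
  finally show ?case by (simp add: Suc.IH)
qed

text \<open>The z a are the coefficients of a polynomial of degree below n with the n distinct roots
  \<mu> c, so it vanishes.\<close>

lemma vandermonde_kernel:
  fixes \<mu> z :: "nat \<Rightarrow> 'k::field"
  assumes "inj_on \<mu> {0..<n}" "\<And>c. c < n \<Longrightarrow> (\<Sum>a\<in>{0..<n}. \<mu> c ^ a * z a) = 0" "a < n"
  shows "z a = 0"
proof -
  define q where "q = (\<Sum>a\<in>{0..<n}. monom (z a) a)"
  have coeff: "coeff q b = (if b < n then z b else 0)" for b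
    by (simp add: q_def coeff_sum)
  have "poly q (\<mu> c) = 0" if "c < n" for c
    using assms(2)[OF that] by (simp add: q_def poly_sum poly_monom mult.commute)
  then have sub: "\<mu> ` {0..<n} \<subseteq> {s. poly q s = 0}"
    by auto
  have "q = 0"
  proof (rule ccontr)
    assume "q \<noteq> 0"
    then have "n \<le> degree q"
      using card_mono[OF poly_roots_finite[OF \<open>q \<noteq> 0\<close>] sub] card_poly_roots_bound[OF \<open>q \<noteq> 0\<close>]
        card_image[OF assms(1)] by simp
    then show False
      using coeff[of "degree q"] \<open>q \<noteq> 0\<close> by simp
  qed
  then show ?thesis using coeff[of a] assms(3) by simp
qed

text \<open>The blocks have the Vandermonde row vectors as common left eigenvectors; the block matrix is
  therefore similar to the block diagonal matrix formed by the matrices of eigenvalues.\<close>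

lemma det_block_mat_eigen:
  fixes \<mu> :: "nat \<Rightarrow> 'k::field" and B :: "nat \<Rightarrow> nat \<Rightarrow> 'k mat"
  assumes inj: "inj_on \<mu> {0..<n}"
    and eigen: "\<And>c i j a. c < n \<Longrightarrow> i < m \<Longrightarrow> j < m \<Longrightarrow> a < n \<Longrightarrow>
      (\<Sum>b\<in>{0..<n}. \<mu> c ^ b * B i j $$ (b, a)) = D c i j * \<mu> c ^ a"
  shows "det (block_mat n m m B) = (\<Prod>c<n. det (mat m m (\<lambda>(i, j). D c i j)))"
proof -
  let ?N = "m * n"
  \<comment> \<open>Rows of \<open>R\<close> are indexed by pairs (eigenvalue c, block i), columns
    by pairs (block j, position a). Row (c, i) is the Vandermonde row of \<mu> c placed in block i,
    so the eigenvector equations say \<open>R * ?M = \<Delta> * R\<close>.\<close>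
  define R where "R = mat ?N ?N (\<lambda>(k, l). if k mod m = l div n then \<mu> (k div m) ^ (l mod n) else 0)"
  define \<Delta> where
    "\<Delta> = block_mat m n n (\<lambda>c c'. if c = c' then mat m m (\<lambda>(i, j). D c i j) else 0\<^sub>m m m)"
  let ?M = "block_mat n m m B"
  have R: "R \<in> carrier_mat ?N ?N" and \<Delta>: "\<Delta> \<in> carrier_mat ?N ?N" and M: "?M \<in> carrier_mat ?N ?N"
    using block_mat_carrier[of m n n] by (auto simp: R_def \<Delta>_def mult.commute)
  have "R * ?M = \<Delta> * R"
  proof (rule eq_matI)
    fix k l assume "k < dim_row (\<Delta> * R)" "l < dim_col (\<Delta> * R)"
    then have kl: "k < ?N" "l < ?N" using R \<Delta> by auto
    define c i j a where cija: "c = k div m" "i = k mod m" "j = l div n" "a = l mod n"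
    have bounds: "c < n" "i < m" "j < m" "a < n"
      using kl div_less_mult[of k n m] mod_less_mult[of k n m] div_less_mult[of l m n]
        mod_less_mult[of l m n] by (auto simp: cija mult.commute)
    have "(R * ?M) $$ (k, l) = (\<Sum>p\<in>{0..<?N}. R $$ (k, p) * ?M $$ (p, l))"
      using kl R M by (simp add: scalar_prod_def)
    also have "\<dots> = (\<Sum>p\<in>{0..<?N}.
        if p div n = i then \<mu> c ^ (p mod n) * B (p div n) j $$ (p mod n, a) else 0)"
      using kl by (intro sum.cong) (auto simp: R_def index_block_mat cija)
    also have "\<dots> = (\<Sum>i'\<in>{0..<m}. \<Sum>b\<in>{0..<n}. if i' = i then \<mu> c ^ b * B i' j $$ (b, a) else 0)"
      by (rule sum_div_mod)
    also have "\<dots> = (\<Sum>i'\<in>{0..<m}. if i' = i then \<Sum>b\<in>{0..<n}. \<mu> c ^ b * B i' j $$ (b, a) else 0)"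
      by (intro sum.cong) auto
    also have "\<dots> = D c i j * \<mu> c ^ a"
      using bounds by (simp add: eigen)
    finally have L: "(R * ?M) $$ (k, l) = D c i j * \<mu> c ^ a" .
    have "(\<Delta> * R) $$ (k, l) = (\<Sum>p\<in>{0..<?N}. \<Delta> $$ (k, p) * R $$ (p, l))"
      using kl R \<Delta> by (simp add: scalar_prod_def)
    also have "\<dots> = (\<Sum>p\<in>{0..<n * m}. if p div m = c then
        if p mod m = j then D c i (p mod m) * \<mu> (p div m) ^ a else 0 else 0)"
      using kl bounds
      by (intro sum.cong)
        (auto simp: R_def \<Delta>_def index_block_mat cija mult.commute mod_less_mult)
    also have "\<dots> = (\<Sum>c'\<in>{0..<n}. \<Sum>j'\<in>{0..<m}. if c' = c then
        if j' = j then D c i j' * \<mu> c' ^ a else 0 else 0)"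
      by (rule sum_div_mod)
    also have "\<dots> = (\<Sum>c'\<in>{0..<n}. if c' = c then D c i j * \<mu> c' ^ a else 0)"
      using bounds by (intro sum.cong) auto
    also have "\<dots> = D c i j * \<mu> c ^ a"
      using bounds by simp
    finally show "(R * ?M) $$ (k, l) = (\<Delta> * R) $$ (k, l)" using L by simp
  qed (use R \<Delta> M in auto)
  then have "det R * det ?M = det R * det \<Delta>"
    using det_mult[OF R M] det_mult[OF \<Delta> R] by (metis mult.commute)
  \<comment> \<open>A kernel vector of \<open>R\<close> would, cut into segments of length n, give
    vectors annihilated by all Vandermonde rows.\<close>
  moreover have "det R \<noteq> 0"
  proof
    assume "det R = 0"
    then obtain v where v: "v \<in> carrier_vec ?N" "v \<noteq> 0\<^sub>v ?N" "R *\<^sub>v v = 0\<^sub>v ?N"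
      using det_0_iff_vec_prod_zero_field[OF R] by auto
    have "v $ k = 0" if "k < ?N" for k
    proof -
      define i where "i = k div n"
      have i: "i < m" using div_less_mult[OF that] by (simp add: i_def)
      have "(\<Sum>a\<in>{0..<n}. \<mu> c ^ a * v $ (i * n + a)) = 0" if "c < n" for c
      proof -
        \<comment> \<open>The row of \<open>R\<close> for the eigenvalue \<mu> c and the block
          i.\<close>
        define l where "l = i + c * m"
        have "l < c * m + m" using i by (simp add: l_def)
        also have "\<dots> \<le> n * m" using mult_le_mono1[of "Suc c" n m] \<open>c < n\<close> by simp
        finally have l: "l < ?N" by (simp add: mult.commute)
        have lc: "l div m = c" "l mod m = i" using i by (auto simp: l_def)
        have "0 = (R *\<^sub>v v) $ l" using v l by simp
        also have "\<dots> = (\<Sum>p\<in>{0..<?N}. R $$ (l, p) * v $ p)"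
          using v(1) l R by (auto simp: scalar_prod_def)
        also have "\<dots> = (\<Sum>p\<in>{0..<?N}. if p div n = i then \<mu> c ^ (p mod n) * v $ (p div n * n + p mod n) else 0)"
          using l by (intro sum.cong) (auto simp: R_def lc)
        also have "\<dots> = (\<Sum>i'\<in>{0..<m}. \<Sum>a\<in>{0..<n}. if i' = i then \<mu> c ^ a * v $ (i' * n + a) else 0)"
          by (rule sum_div_mod)
        also have "\<dots> = (\<Sum>i'\<in>{0..<m}. if i' = i then \<Sum>a\<in>{0..<n}. \<mu> c ^ a * v $ (i' * n + a) else 0)"
          by (intro sum.cong) auto
        finally show ?thesis using i by simp
      qed
      from vandermonde_kernel[OF inj this mod_less_mult[OF that]]
      show ?thesis by (simp add: i_def)
    qed
    then have "v = 0\<^sub>v ?N" using v(1) by (intro eq_vecI) auto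
    with v(2) show False by simp
  qed
  ultimately have "det ?M = det \<Delta>" by simp
  also have "\<dots> = (\<Prod>c<n. det (mat m m (\<lambda>(i, j). D c i j)))"
    unfolding \<Delta>_def by (rule det_block_diagonal) auto
  finally show ?thesis .
qed


section \<open>Torsion of a complex of length two\<close>

text \<open>Chains are row vectors, on which the boundary acts from the right; the transposed action
  in \<open>basis_mat\<close> thus becomes a matrix product.\<close>

lemma mat_of_rows_map_transpose:
  fixes d :: "'k::field mat"
  assumes "d \<in> carrier_mat q r" "set vs \<subseteq> carrier_vec q"
  shows "mat_of_rows r (map (\<lambda>v. transpose_mat d *\<^sub>v v) vs) = mat_of_rows q vs * d"
proof (rule eq_matI)
  fix i j assume "i < dim_row (mat_of_rows q vs * d)" "j < dim_col (mat_of_rows q vs * d)"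
  then have ij: "i < length vs" "j < r" using assms by auto
  then have row: "row (mat_of_rows q vs) i = vs ! i"
    using assms by (intro mat_of_rows_row) auto
  have "col d j \<bullet> vs ! i = vs ! i \<bullet> col d j"
    using ij assms by (intro comm_scalar_prod[of _ q]) (auto simp: subset_iff)
  then show "mat_of_rows r (map (\<lambda>v. transpose_mat d *\<^sub>v v) vs) $$ (i, j) = (mat_of_rows q vs * d) $$ (i, j)"
    using ij assms row by (simp add: mat_of_rows_index)
qed (use assms in auto)

text \<open>Right multiplication by the matrix whose first \<open>p\<close> columns are those of \<open>d1\<close>, completed by
  unit vectors, annihilates the rows \<open>\<partial>b\<^sub>2\<close> in these columns because \<open>d2 d1 = 0\<close>. This separates
  \<open>b1\<close> from \<open>b2\<close> in the middle determinant.\<close>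

lemma det_middle_basis:
  fixes d1 d2 :: "'k::field mat"
  assumes d1: "d1 \<in> carrier_mat (p + q) p" and d2: "d2 \<in> carrier_mat q (p + q)"
    and zero: "d2 * d1 = 0\<^sub>m q p"
    and b1: "set b1 \<subseteq> carrier_vec (p + q)" "length b1 = p"
    and b2: "set b2 \<subseteq> carrier_vec q" "length b2 = q"
  shows "det (mat_of_rows (p + q) (map (\<lambda>v. transpose_mat d2 *\<^sub>v v) b2 @ b1)) *
      det (mat p p (\<lambda>(i, j). d1 $$ (i, j))) =
    (- 1) ^ (p * q) * det (mat_of_rows p (map (\<lambda>v. transpose_mat d1 *\<^sub>v v) b1)) *
      det (mat_of_rows q b2) * det (mat q q (\<lambda>(i, j). d2 $$ (i, p + j)))"
proof -
  define T where "T = mat p p (\<lambda>(i, j). d1 $$ (i, j))"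
  define T' where "T' = mat q p (\<lambda>(i, j). d1 $$ (p + i, j))"
  define M where "M = mat q q (\<lambda>(i, j). d2 $$ (i, p + j))"
  define A where "A = mat_of_rows (p + q) (map (\<lambda>v. transpose_mat d2 *\<^sub>v v) b2 @ b1)"
  define B1 where "B1 = mat_of_rows (p + q) b1"
  define B2 where "B2 = mat_of_rows q b2"
  define U where "U = mat p q (\<lambda>(i, j). B1 $$ (i, p + j))"
  define E where "E = four_block_mat T (0\<^sub>m p q) T' (1\<^sub>m q)"
  have carrier: "T \<in> carrier_mat p p" "T' \<in> carrier_mat q p" "M \<in> carrier_mat q q"
      "B1 \<in> carrier_mat p (p + q)" "B2 \<in> carrier_mat q q" "U \<in> carrier_mat p q"
      "E \<in> carrier_mat (p + q) (p + q)" "A \<in> carrier_mat (p + q) (p + q)"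
    using b1 b2 by (auto simp: T_def T'_def M_def B1_def B2_def U_def E_def A_def)
  have detE: "det E = det T"
    unfolding E_def by (subst det_four_block_mat_upper_right_zero[of _ p _ q]) (use carrier in auto)
  have colE1: "col E j = col d1 j" if "j < p" for j
    using that d1 carrier by (intro eq_vecI) (auto simp: E_def T_def T'_def)
  have colE2: "col E (p + j) = unit_vec (p + q) (p + j)" if "j < q" for j
    using that carrier by (intro eq_vecI) (auto simp: E_def)
  have boundary: "transpose_mat d2 *\<^sub>v v \<in> carrier_vec (p + q)" for v
    using d2 by (intro carrier_vecI) simp
  have rowA1: "row A i = row (B2 * d2) i" if "i < q" for i
  proof -
    have "row A i = map (\<lambda>v. transpose_mat d2 *\<^sub>v v) b2 ! i"
      unfolding A_def using that b2 boundary by (subst mat_of_rows_row) (auto simp: nth_append)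
    also have "\<dots> = row (mat_of_rows (p + q) (map (\<lambda>v. transpose_mat d2 *\<^sub>v v) b2)) i"
      using that b2 boundary by (subst mat_of_rows_row) auto
    also have "\<dots> = row (B2 * d2) i"
      unfolding B2_def using mat_of_rows_map_transpose[OF d2 b2(1)] by simp
    finally show ?thesis .
  qed
  have rowA2: "row A (q + i) = row B1 i" if "i < p" for i
  proof -
    have "b1 ! i \<in> carrier_vec (p + q)" using that b1 by auto
    then show ?thesis unfolding A_def B1_def using that b1 b2
      by (subst (1 2) mat_of_rows_row) (auto simp: nth_append)
  qed
  have zero': "B2 * d2 * d1 = 0\<^sub>m q p"
    using carrier(5) d2 d1 zero by (simp add: assoc_mult_mat[of _ q q _ "p + q" _ p])
  have AE: "A * E \<in> carrier_mat (p + q) (p + q)" using carrier by auto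
  \<comment> \<open>Moving the p rows of \<open>b1\<close> above the q rows coming from
    \<open>b2\<close> makes the product block upper triangular; the move costs the sign
    (-1)^(pq).\<close>
  have "mat (p + q) (p + q) (\<lambda>(i, j). (A * E) $$ (if i < p then i + q else i - p, j)) =
      four_block_mat (B1 * d1) U (0\<^sub>m q p) (B2 * M)" (is "_ = ?F")
  proof (rule eq_matI)
    fix i j assume "i < dim_row ?F" "j < dim_col ?F"
    then have i: "i < p + q" and j: "j < p + q" using carrier d1 by auto
    have *: "(A * E) $$ (k, j) = row A k \<bullet> col E j" if "k < p + q" for k
      using that j carrier by auto
    show "mat (p + q) (p + q) (\<lambda>(i, j). (A * E) $$ (if i < p then i + q else i - p, j)) $$ (i, j) =
        ?F $$ (i, j)"
    proof (cases "i < p")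
      case True
      then have l: "mat (p + q) (p + q) (\<lambda>(i, j). (A * E) $$ (if i < p then i + q else i - p, j)) $$ (i, j) =
          row B1 i \<bullet> col E j"
        using i j *[of "q + i"] rowA2[OF True] by (simp add: add.commute)
      show ?thesis
      proof (cases "j < p")
        case j': True
        then show ?thesis unfolding l using True carrier d1 by (simp add: colE1)
      next
        case False
        then obtain j' where j': "j = p + j'" "j' < q" using j le_Suc_ex[of p j] by auto
        then show ?thesis unfolding l using True carrier d1 by (simp add: colE2 U_def)
      qed
    next
      case False
      then obtain i' where i': "i = p + i'" "i' < q" using i le_Suc_ex[of p i] by auto
      then have l: "mat (p + q) (p + q) (\<lambda>(i, j). (A * E) $$ (if i < p then i + q else i - p, j)) $$ (i, j) =
          row (B2 * d2) i' \<bullet> col E j"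
        using i j *[of i'] rowA1[of i'] by simp
      show ?thesis
      proof (cases "j < p")
        case j': True
        then have "row (B2 * d2) i' \<bullet> col E j = (B2 * d2 * d1) $$ (i', j)"
          using i' j' carrier d1 d2 by (subst index_mult_mat(1)) (auto simp: colE1)
        then show ?thesis unfolding l zero' using i' j' carrier d1 by simp
      next
        case False
        then obtain j' where j': "j = p + j'" "j' < q" using j le_Suc_ex[of p j] by auto
        have "col d2 (p + j') = col M j'"
          using j' d2 by (intro eq_vecI) (auto simp: M_def)
        then have "row (B2 * d2) i' \<bullet> col E j = (B2 * M) $$ (i', j')"
          using i' j' carrier d2 by (simp add: colE2)
        then show ?thesis unfolding l using i' j' carrier d1 by simp
      qed
    qed
  qed (use carrier d1 in auto)
  then have "det (A * E) = (- 1) ^ (p * q) * det (four_block_mat (B1 * d1) U (0\<^sub>m q p) (B2 * M))"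
    using det_swap_rows[OF AE] by simp
  also have "det (four_block_mat (B1 * d1) U (0\<^sub>m q p) (B2 * M)) = det (B1 * d1) * det (B2 * M)"
    by (rule det_four_block_mat_lower_left_zero[of _ p]) (use carrier d1 in auto)
  also have "det (B2 * M) = det B2 * det M"
    using carrier by (intro det_mult) auto
  also have "det (A * E) = det A * det T"
    using carrier det_mult[of A "p + q" E] detE by simp
  also have "B1 * d1 = mat_of_rows p (map (\<lambda>v. transpose_mat d1 *\<^sub>v v) b1)"
    unfolding B1_def using mat_of_rows_map_transpose[OF d1 b1(1)] by simp
  finally show ?thesis by (simp add: A_def T_def B2_def M_def mult.assoc)
qed

text \<open>By \<open>det_middle_basis\<close> the middle determinant contains the two outer ones as
  factors, so they cancel and the value does not depend on b. Unit vectors show that an admissible b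
  exists.\<close>

lemma reidemeister_torsion_length_two:
  fixes d :: "nat \<Rightarrow> 'k::field mat"
  assumes c: "c 0 = p" "c 1 = p + q" "c 2 = q"
    and d1: "d 1 \<in> carrier_mat (p + q) p" and d2: "d 2 \<in> carrier_mat q (p + q)"
    and zero: "d 2 * d 1 = 0\<^sub>m q p"
    and T: "det (mat p p (\<lambda>(i, j). d 1 $$ (i, j))) \<noteq> 0"
    and M: "det (mat q q (\<lambda>(i, j). d 2 $$ (i, p + j))) \<noteq> 0"
  shows "reidemeister_torsion 2 c d =
    (- 1) ^ (p * q) * det (mat q q (\<lambda>(i, j). d 2 $$ (i, p + j))) / det (mat p p (\<lambda>(i, j). d 1 $$ (i, j)))"
    (is "_ = ?\<tau>")
proof -
  have sets: "{1..2} = {1, 2::nat}" "{2..2} = {2::nat}" "{0..2} = {0, 1, 2::nat}" by auto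
  have complex: "is_chain_complex 2 c d"
    unfolding is_chain_complex_def sets using assms by (simp add: numeral_2_eq_2)
  let ?rows1 = "\<lambda>b. mat_of_rows p (map (\<lambda>v. transpose_mat (d 1) *\<^sub>v v) (b 1))"
  let ?rows2 = "\<lambda>b. mat_of_rows (p + q) (map (\<lambda>v. transpose_mat (d 2) *\<^sub>v v) (b 2) @ b 1)"
  have basis: "basis_mat c d b 0 = ?rows1 b" "basis_mat c d b 1 = ?rows2 b"
      "basis_mat c d b 2 = mat_of_rows q (b 2)" if "b 0 = []" "b 3 = []" for b
    using that c by (simp_all add: basis_mat_def numeral_2_eq_2 numeral_3_eq_3)
  have unique: "\<tau> = ?\<tau>" if "is_torsion 2 c d \<tau>" for \<tau>
  proof -
    obtain b where b: "b 0 = []" "b 3 = []"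
        "\<And>i. i \<in> {0..2} \<Longrightarrow> set (b i) \<subseteq> carrier_vec (c i)"
        "\<And>i. i \<in> {0..2} \<Longrightarrow> length (b (Suc i)) + length (b i) = c i"
        "\<And>i. i \<in> {0..2} \<Longrightarrow> det (basis_mat c d b i) \<noteq> 0"
        and \<tau>: "\<tau> = (\<Prod>i=0..2. det (basis_mat c d b i) powi ((- 1) ^ Suc i))"
      using \<open>is_torsion 2 c d \<tau>\<close> by (auto simp: is_torsion_def numeral_3_eq_3 numeral_2_eq_2)
    \<comment> \<open>The empty ends \<open>b 0\<close> and \<open>b 3\<close> force these
      lengths.\<close>
    have len: "length (b 1) = p" "length (b 2) = q"
      using b(1,2) b(4)[of 0] b(4)[of 2] c by (simp_all add: numeral_3_eq_3)
    \<comment> \<open>The exponents (-1)^(i+1) put degree 1 in the numerator and degrees 0 and 2 in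
      the denominator.\<close>
    have "\<tau> = det (?rows2 b) / (det (?rows1 b) * det (mat_of_rows q (b 2)))"
      unfolding \<tau> sets using basis[OF b(1,2)] by (simp add: power_int_minus field_simps)
    moreover have "det (?rows1 b) \<noteq> 0" "det (mat_of_rows q (b 2)) \<noteq> 0"
      using b(5)[of 0] b(5)[of 2] basis[OF b(1,2)] by simp_all
    moreover have "set (b 1) \<subseteq> carrier_vec (p + q)" "set (b 2) \<subseteq> carrier_vec q"
      using b(3)[of 1] b(3)[of 2] c by simp_all
    moreover have "D / (r1 * r2) = s * y / z"
      if "D * z = s * r1 * r2 * y" "r1 \<noteq> 0" "r2 \<noteq> 0" "z \<noteq> 0" for D z s r1 r2 y :: 'k
      using that by (simp add: field_simps)
    ultimately show ?thesis
      using det_middle_basis[OF d1 d2 zero, of "b 1" "b 2"] len T by blast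
  qed
  have "\<exists>\<tau>. is_torsion 2 c d \<tau>"
  proof -
    \<comment> \<open>With these lifts the outer determinants are that of the top square part of
      \<open>d 1\<close> and 1. The middle one is then nonzero by \<open>det_middle_basis\<close>
      and \<open>M\<close>.\<close>
    define b where "b = (\<lambda>_::nat. [])(1 := map (unit_vec (p + q)) [0..<p], 2 := map (unit_vec q) [0..<q] :: 'k vec list)"
    have b: "b 0 = []" "b 3 = []" "set (b 1) \<subseteq> carrier_vec (p + q)" "length (b 1) = p"
        "set (b 2) \<subseteq> carrier_vec q" "length (b 2) = q"
      by (auto simp: b_def)
    have "?rows1 b = mat p p (\<lambda>(i, j). d 1 $$ (i, j))"
      using d1 by (intro eq_matI) (auto simp: b_def mat_of_rows_index)
    then have det0: "det (?rows1 b) \<noteq> 0" using T by simp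
    have "mat_of_rows q (b 2) = 1\<^sub>m q"
      by (intro eq_matI) (auto simp: b_def mat_of_rows_index)
    then have det2: "det (mat_of_rows q (b 2)) = 1" by simp
    have det1: "det (?rows2 b) \<noteq> 0"
      using det_middle_basis[OF d1 d2 zero b(3-6)] det0 det2 M by auto
    have "\<forall>i\<in>{0..2}. set (b i) \<subseteq> carrier_vec (c i) \<and>
        length (b (Suc i)) + length (b i) = c i \<and> det (basis_mat c d b i) \<noteq> 0"
      unfolding sets using b c basis[OF b(1,2)] det0 det1 det2
      by (auto simp: numeral_2_eq_2 numeral_3_eq_3)
    then show ?thesis
      unfolding is_torsion_def using complex b(1,2) by (auto simp: numeral_2_eq_2 numeral_3_eq_3)
  qed
  then obtain \<tau> where "is_torsion 2 c d \<tau>" by auto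
  then show ?thesis
    unfolding reidemeister_torsion_def using unique by (metis (mono_tags, lifting) the_equality)
qed


section \<open>Companion matrices\<close>

text \<open>Acting on the row (1, s, s^2, ...), all columns but the last shift the powers of s; in
  the last one q(s) = 0 rewrites the leading power.\<close>

lemma companion_left_eigenvector:
  fixes q :: "'a::comm_ring_1 poly"
  assumes "lead_coeff q = 1" "poly q s = 0" "a < degree q"
  shows "(\<Sum>b\<in>{0..<degree q}. s ^ b * companion q $$ (b, a)) = s * s ^ a"
proof (cases "Suc a = degree q")
  case True
  have "0 = (\<Sum>b\<le>degree q. coeff q b * s ^ b)"
    using assms(2) by (simp add: poly_altdef)
  also have "\<dots> = (\<Sum>b\<in>{0..<degree q}. coeff q b * s ^ b) + s ^ degree q"
    using assms(1) by (simp add: atLeast0LessThan flip: lessThan_Suc_atMost)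
  finally have "- (\<Sum>b\<in>{0..<degree q}. coeff q b * s ^ b) = s ^ degree q"
    by (simp add: neg_eq_iff_add_eq_0)
  moreover have "(\<Sum>b\<in>{0..<degree q}. s ^ b * companion q $$ (b, a)) =
      - (\<Sum>b\<in>{0..<degree q}. coeff q b * s ^ b)"
    unfolding sum_negf[symmetric] using True assms(3)
    by (intro sum.cong) (auto simp: companion_def mult.commute)
  ultimately show ?thesis by (simp flip: True)
next
  case False
  then have "(\<Sum>b\<in>{0..<degree q}. s ^ b * companion q $$ (b, a)) =
      (\<Sum>b\<in>{0..<degree q}. if b = Suc a then s ^ b else 0)"
    using assms(3) by (intro sum.cong) (auto simp: companion_def)
  then show ?thesis using False assms(3) by simp
qed

lemma map_mat_companion:
  "map_mat of_int (companion q) = companion (map_poly of_int q :: 'a::{comm_ring_1,ring_char_0} poly)"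
proof -
  have "degree (map_poly of_int q :: 'a poly) = degree q"
    by (rule degree_map_poly) simp
  then show ?thesis by (intro eq_matI) (auto simp: companion_def coeff_map_poly)
qed


section \<open>Evaluation of integral polynomials\<close>

lemma eval_int_poly_pCons [simp]:
  "eval_int_poly (pCons a q) s = of_int a + s * eval_int_poly q s"
  by (simp add: eval_int_poly_def map_poly_pCons)

lemma eval_int_poly_0 [simp]: "eval_int_poly 0 s = 0"
  and eval_int_poly_1 [simp]: "eval_int_poly 1 s = 1"
  and eval_int_poly_monom [simp]: "eval_int_poly (monom c k) s = of_int c * s ^ k"
  by (simp_all add: eval_int_poly_def map_poly_monom poly_monom)

lemma eval_int_poly_add [simp]:
  "eval_int_poly (q + q') s = eval_int_poly q s + eval_int_poly q' s"
proof -
  have "map_poly of_int (q + q') = map_poly of_int q + (map_poly of_int q' :: 'a poly)"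
    by (rule poly_eqI) (simp add: coeff_map_poly)
  then show ?thesis by (simp add: eval_int_poly_def)
qed

lemma eval_int_poly_mult [simp]:
  "eval_int_poly (q * q') s = eval_int_poly q s * eval_int_poly q' s"
proof -
  have "map_poly of_int (q * q') = map_poly of_int q * (map_poly of_int q' :: 'a poly)"
    by (rule poly_eqI) (simp add: coeff_map_poly coeff_mult)
  then show ?thesis by (simp add: eval_int_poly_def)
qed

lemma comm_ring_hom_eval_int_poly: "comm_ring_hom (\<lambda>q. eval_int_poly q s)"
  by unfold_locales auto

lemma eval_int_poly_sum [simp]:
  "eval_int_poly (\<Sum>i\<in>I. q i) s = (\<Sum>i\<in>I. eval_int_poly (q i) s)"
  by (induction I rule: infinite_finite_induct) auto

lemma comm_ring_hom_const: "comm_ring_hom const"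
  by unfold_locales (auto simp: const_def pCons_one simp flip: to_fract_add to_fract_mult)

interpretation const: comm_ring_hom const
  by (rule comm_ring_hom_const)

lemma tvar_neq_0 [simp]: "tvar \<noteq> 0"
  by (simp add: tvar_def)

lemma const_eq_0_iff [simp]: "const c = 0 \<longleftrightarrow> c = 0"
  by (simp add: const_def)

lemma eval_int_poly_tvar:
  "eval_int_poly q tvar = to_fract (map_poly of_int q :: complex poly)"
proof (induction q rule: pCons_induct)
  case (pCons a q)
  have "(of_int a :: complex poly fract) = to_fract [:of_int a:]"
    using const.hom_of_int[of a] by (simp add: const_def)
  moreover have "pCons (of_int a) (map_poly of_int q) =
      [:of_int a:] + [:0, 1:] * (map_poly of_int q :: complex poly)"
    by simp
  ultimately show ?case
    using pCons.IH by (simp add: map_poly_pCons tvar_def del: mult_pCons_left)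
qed simp

text \<open>The variable t is transcendental, so an identity at \<open>tvar\<close> is one of
  integral polynomials and can be moved to any other argument.\<close>

lemma eval_int_poly_tvar_eq_iff [simp]:
  "eval_int_poly q tvar = eval_int_poly q' tvar \<longleftrightarrow> q = q'"
  unfolding eval_int_poly_tvar by (auto simp: poly_eq_iff coeff_map_poly)

lemma eval_int_poly_tvar_eq_0_iff [simp]: "eval_int_poly q tvar = 0 \<longleftrightarrow> q = 0"
  using eval_int_poly_tvar_eq_iff[of q 0] by simp

text \<open>Keeps the factors ct - 1 of the torsion denominator nonzero.\<close>

lemma const_tvar_neq_1: "const c * tvar \<noteq> 1"
proof
  assume "const c * tvar = 1"
  then have "to_fract ([:c:] * [:0, 1:]) = to_fract [:1:]"
    by (simp only: const_def tvar_def to_fract_mult one_pCons[symmetric] to_fract_1)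
  then show False by simp
qed


section \<open>Substitution in the Alexander polynomial\<close>

text \<open>A single N serves the whole finite set, so that its power can be pulled out of a
  determinant; P is chosen independently of s.\<close>

lemma laurent_clear_denominator:
  assumes "finite A"
  shows "\<exists>N. \<forall>a\<in>A. \<exists>P. \<forall>s::'k::field. s \<noteq> 0 \<longrightarrow> eval_int_poly P s = s ^ N * laurent a s"
proof -
  define W where "W = (\<Union>a\<in>A. Poly_Mapping.keys a)"
  \<comment> \<open>A sum of absolute values bounds each of its terms, hence every negative exponent
    that occurs.\<close>
  define N where "N = (\<Sum>w\<in>W. nat \<bar>exponent_sum w\<bar>)"
  have "finite W" using assms by (simp add: W_def)
  then have N: "nat \<bar>exponent_sum w\<bar> \<le> N" if "w \<in> W" for w
    unfolding N_def using that by (intro member_le_sum) auto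
  have "eval_int_poly (\<Sum>w\<in>Poly_Mapping.keys a. monom (Poly_Mapping.lookup a w) (nat (int N + exponent_sum w))) s
      = s ^ N * laurent a s" if "a \<in> A" "s \<noteq> 0" for a and s :: 'k
  proof -
    have "s ^ nat (int N + exponent_sum w) = s ^ N * s powi exponent_sum w"
      if "w \<in> Poly_Mapping.keys a" for w
    proof -
      have "0 \<le> int N + exponent_sum w"
        using N[of w] \<open>a \<in> A\<close> that by (force simp: W_def)
      then have "s ^ nat (int N + exponent_sum w) = s powi (int N + exponent_sum w)"
        by (simp add: power_int_def)
      then show ?thesis using \<open>s \<noteq> 0\<close> by (simp add: power_int_add)
    qed
    then show ?thesis
      by (simp add: laurent_def sum_distrib_left mult.left_commute)
  qed
  then show ?thesis by blast
qed

text \<open>P is the determinant of the cleared entries; the common scalar s^N contributes the power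
  N m.\<close>

lemma det_laurent_clear_denominator:
  fixes a :: "nat \<Rightarrow> nat \<Rightarrow> ('a word \<Rightarrow>\<^sub>0 int)"
  shows "\<exists>N P. \<forall>s::'k::field. s \<noteq> 0 \<longrightarrow>
    eval_int_poly P s = s ^ N * det (mat m m (\<lambda>(i, j). laurent (a i j) s))"
proof -
  define A where "A = (\<lambda>(i, j). a i j) ` ({0..<m} \<times> {0..<m})"
  have "finite A" by (simp add: A_def)
  from laurent_clear_denominator[OF this, where 'k = 'k]
  obtain N where N: "\<forall>b\<in>A. \<exists>P. \<forall>s::'k. s \<noteq> 0 \<longrightarrow> eval_int_poly P s = s ^ N * laurent b s"
    by (rule exE)
  have "\<exists>P. \<forall>s::'k. s \<noteq> 0 \<longrightarrow> eval_int_poly P s = s ^ N * laurent (a i j) s"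
    if "i < m" "j < m" for i j
    using that by (intro bspec[OF N]) (auto simp: A_def intro!: rev_image_eqI[of "(i, j)"])
  then obtain P where P:
    "eval_int_poly (P i j) s = s ^ N * laurent (a i j) s" if "i < m" "j < m" "s \<noteq> 0" for i j and s :: 'k
    by metis
  have "eval_int_poly (det (mat m m (\<lambda>(i, j). P i j))) s =
      s ^ (N * m) * det (mat m m (\<lambda>(i, j). laurent (a i j) s))" if "s \<noteq> 0" for s :: 'k
  proof -
    interpret eval: comm_ring_hom "\<lambda>q. eval_int_poly q s" by (rule comm_ring_hom_eval_int_poly)
    have "eval_int_poly (det (mat m m (\<lambda>(i, j). P i j))) s =
        det (map_mat (\<lambda>q. eval_int_poly q s) (mat m m (\<lambda>(i, j). P i j)))"
      by (rule eval.hom_det[symmetric])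
    also have "map_mat (\<lambda>q. eval_int_poly q s) (mat m m (\<lambda>(i, j). P i j)) =
        s ^ N \<cdot>\<^sub>m mat m m (\<lambda>(i, j). laurent (a i j) s)"
      using that by (intro eq_matI) (auto simp: P)
    finally show ?thesis by (simp add: power_mult)
  qed
  then show ?thesis by blast
qed

text \<open>Up to a power of s, P has the coefficients of f in reverse order.\<close>

lemma eval_inverse_clear_denominator:
  "\<exists>N P. \<forall>s::'k::field. s \<noteq> 0 \<longrightarrow> eval_int_poly P s = s ^ N * eval_int_poly f (inverse s)"
proof (induction f rule: pCons_induct)
  case (pCons a f)
  then obtain N P where P: "\<And>s::'k. s \<noteq> 0 \<Longrightarrow> eval_int_poly P s = s ^ N * eval_int_poly f (inverse s)"
    by auto
  have "eval_int_poly (monom a (Suc N) + P) s = s ^ Suc N * eval_int_poly (pCons a f) (inverse s)"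
    if "s \<noteq> 0" for s :: 'k
    using that by (simp add: P field_simps)
  then show ?case by blast
qed (auto intro: exI[of _ 0])

text \<open>After clearing denominators the hypothesis becomes an identity in \<open>\<int>[t]\<close>, which may be
  evaluated at any \<open>s\<close>.\<close>

lemma det_laurent_substitute:
  fixes a :: "nat \<Rightarrow> nat \<Rightarrow> ('a word \<Rightarrow>\<^sub>0 int)" and m :: nat
  defines "\<Lambda> \<equiv> \<lambda>s. det (mat m m (\<lambda>(i, j). laurent (a i j) s))"
  assumes "\<Lambda> tvar \<doteq> eval_int_poly f tvar * eval_int_poly f (inverse tvar)"
  obtains \<sigma> k :: int where "\<sigma> = 1 \<or> \<sigma> = -1"
    "\<And>s. s \<noteq> 0 \<Longrightarrow> \<Lambda> s = of_int \<sigma> * s powi k * (eval_int_poly f s * eval_int_poly f (inverse s))"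
proof -
  from assms(2) obtain k :: int where
    "\<Lambda> tvar = tvar powi k * (eval_int_poly f tvar * eval_int_poly f (inverse tvar)) \<or>
     \<Lambda> tvar = - (tvar powi k * (eval_int_poly f tvar * eval_int_poly f (inverse tvar)))"
    unfolding eq_unit_def by blast
  then have "\<exists>\<sigma>::int. (\<sigma> = 1 \<or> \<sigma> = -1) \<and>
      \<Lambda> tvar = of_int \<sigma> * tvar powi k * (eval_int_poly f tvar * eval_int_poly f (inverse tvar))"
  proof
    assume "\<Lambda> tvar = tvar powi k * (eval_int_poly f tvar * eval_int_poly f (inverse tvar))"
    then show ?thesis by (intro exI[of _ 1]) simp
  next
    assume "\<Lambda> tvar = - (tvar powi k * (eval_int_poly f tvar * eval_int_poly f (inverse tvar)))"
    then show ?thesis by (intro exI[of _ "-1"]) simp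
  qed
  then obtain \<sigma> :: int where \<sigma>: "\<sigma> = 1 \<or> \<sigma> = -1" and
    \<Lambda>: "\<Lambda> tvar = of_int \<sigma> * tvar powi k * (eval_int_poly f tvar * eval_int_poly f (inverse tvar))"
    by blast
  obtain N P where P: "\<And>s::complex poly fract. s \<noteq> 0 \<Longrightarrow> eval_int_poly P s = s ^ N * \<Lambda> s"
    using det_laurent_clear_denominator unfolding \<Lambda>_def by metis
  obtain N' P' where P': "\<And>s::complex poly fract. s \<noteq> 0 \<Longrightarrow>
      eval_int_poly P' s = s ^ N' * eval_int_poly f (inverse s)"
    using eval_inverse_clear_denominator by metis
  \<comment> \<open>Positive and negative part of k, so that only natural exponents remain after
    multiplication by s^k2.\<close>
  define k1 k2 where "k1 = nat k" and "k2 = nat (- k)"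
  have k: "s ^ k2 * s powi k = s ^ k1" if "s \<noteq> 0" for s :: "complex poly fract"
    using that by (auto simp: k1_def k2_def power_int_def field_simps)
  \<comment> \<open>Both sides of the hypothesis times s^(k2 + N + N'). Once they agree as
    polynomials, the same \<sigma> and k serve every nonzero s.\<close>
  let ?L = "monom 1 (k2 + N') * P" and ?R = "monom \<sigma> (k1 + N) * f * P'"
  have L: "eval_int_poly ?L s = s ^ (k2 + N + N') * \<Lambda> s" if "s \<noteq> 0" for s
    using that by (simp add: P power_add mult_ac)
  have R: "eval_int_poly ?R s = s ^ (k2 + N + N') *
      (of_int \<sigma> * s powi k * (eval_int_poly f s * eval_int_poly f (inverse s)))"
    if "s \<noteq> 0" for s :: "complex poly fract"
    using that by (simp add: P' power_add mult_ac flip: k)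
  have "eval_int_poly ?L tvar = eval_int_poly ?R tvar"
    by (simp only: L[OF tvar_neq_0] R[OF tvar_neq_0] \<Lambda>)
  then have "?L = ?R" by (simp only: eval_int_poly_tvar_eq_iff)
  then have "\<Lambda> s = of_int \<sigma> * s powi k * (eval_int_poly f s * eval_int_poly f (inverse s))"
    if "s \<noteq> 0" for s
    using L[OF that] R[OF that] that by (metis mult_left_cancel power_not_zero)
  with \<sigma> show thesis by (rule that)
qed


section \<open>Torsion of a cyclic representation\<close>

text \<open>The algebraic data of a Wirtinger presentation from which the twisted complex is
  computed.\<close>

locale meridional_presentation =
  fixes G :: "('g, 'b) monoid_scheme" and m :: nat and x :: "nat \<Rightarrow> 'g" and r :: "nat \<Rightarrow> nat word"
    and \<epsilon> :: "'g \<Rightarrow> int"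
  assumes group: "group G" and x: "x \<in> {0..m} \<rightarrow> carrier G"
    and letters: "\<And>i. i \<in> {1..m} \<Longrightarrow> fst ` set (r i) \<subseteq> {0..m}"
    and relator: "\<And>i. i \<in> {1..m} \<Longrightarrow> exponent_sum (r i) = 0"
    and \<epsilon>: "\<epsilon> \<in> hom G integer_group" and \<epsilon>_x: "\<And>j. j \<le> m \<Longrightarrow> \<epsilon> (x j) = 1"
begin

interpretation group G by (rule group)

lemma word_eval_Cons:
  "word_eval G x (l # w) = (if snd l then x (fst l) else inv\<^bsub>G\<^esub> x (fst l)) \<otimes>\<^bsub>G\<^esub> word_eval G x w"
  by (simp add: word_eval_def)

lemma word_eval_Nil: "word_eval G x [] = \<one>\<^bsub>G\<^esub>"
  by (simp add: word_eval_def)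

lemma x_closed: "j \<le> m \<Longrightarrow> x j \<in> carrier G"
  using x by auto

lemma word_eval_closed: "fst ` set w \<subseteq> {0..m} \<Longrightarrow> word_eval G x w \<in> carrier G"
  by (induction w) (auto simp: word_eval_Nil word_eval_Cons x_closed)

lemma \<epsilon>_word_eval: "fst ` set w \<subseteq> {0..m} \<Longrightarrow> \<epsilon> (word_eval G x w) = exponent_sum w"
proof (induction w)
  case Nil
  show ?case
    using group_hom.hom_one[of G integer_group \<epsilon>] \<epsilon> group group_integer_group
    by (simp add: word_eval_Nil group_hom_def group_hom_axioms_def)
next
  case (Cons l w)
  have mult: "\<epsilon> (g \<otimes>\<^bsub>G\<^esub> h) = \<epsilon> g + \<epsilon> h" if "g \<in> carrier G" "h \<in> carrier G" for g h
    using hom_mult[OF \<epsilon> that] by simp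
  have l: "x (fst l) \<in> carrier G" "\<epsilon> (x (fst l)) = 1" using Cons.prems x_closed \<epsilon>_x by auto
  have "\<epsilon> (inv\<^bsub>G\<^esub> x (fst l)) = - 1"
    using group_hom.hom_inv[of G integer_group \<epsilon> "x (fst l)"] \<epsilon> group group_integer_group l
    by (simp add: group_hom_def group_hom_axioms_def)
  with l show ?case
    using Cons word_eval_closed[of w] by (auto simp: word_eval_Cons mult letter_exp_def)
qed

lemma keys_fox_letters:
  "i \<in> {1..m} \<Longrightarrow> w \<in> Poly_Mapping.keys (fox j (r i)) \<Longrightarrow> fst ` set w \<subseteq> {0..m}"
  using set_keys_fox[of w j "r i"] letters[of i] by blast

text \<open>For the trivial one-dimensional representation each block is a single entry, the Fox
  derivative evaluated at x_j -> t.\<close>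

lemma alexander_polynomial_eq:
  "alexander_polynomial G m x r \<epsilon> =
    det (mat m m (\<lambda>(i, j). laurent (fox (Suc j) (r (Suc i))) tvar))"
proof -
  have "fox_mat0 G m x r 1 \<epsilon> (\<lambda>_. 1\<^sub>m 1) =
      mat m m (\<lambda>(i, j). laurent (fox (Suc j) (r (Suc i))) tvar)"
  proof (rule eq_matI)
    fix i j assume "i < dim_row (mat m m (\<lambda>(i, j). laurent (fox (Suc j) (r (Suc i))) tvar))"
      "j < dim_col (mat m m (\<lambda>(i, j). laurent (fox (Suc j) (r (Suc i))) tvar))"
    then have ij: "i < m" "j < m" by auto
    have "\<epsilon> (word_eval G x w) = exponent_sum w" if "w \<in> Poly_Mapping.keys (fox (Suc j) (r (Suc i)))" for w
      using keys_fox_letters[OF _ that] ij by (intro \<epsilon>_word_eval) auto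
    then show "fox_mat0 G m x r 1 \<epsilon> (\<lambda>_. 1\<^sub>m 1) $$ (i, j) =
        mat m m (\<lambda>(i, j). laurent (fox (Suc j) (r (Suc i))) tvar) $$ (i, j)"
      using ij by (simp add: fox_mat0_def index_block_mat Phi_free_def Phi_def laurent_def)
  qed (simp_all add: fox_mat0_def)
  then show ?thesis by (simp add: alexander_polynomial_def)
qed

end

text \<open>All generators share the left eigenvectors (1, \<mu> c, ..., (\<mu> c)^(n-1)), as they
  do when each is sent to one companion matrix with distinct nonzero eigenvalues \<mu> c.\<close>

locale cyclic_representation = meridional_presentation G m x r \<epsilon>
  for G :: "('g, 'b) monoid_scheme" and m x r \<epsilon> +
  fixes n :: nat and \<gamma> :: "'g \<Rightarrow> complex mat" and \<mu> :: "nat \<Rightarrow> complex"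
  assumes \<gamma>_carrier: "\<And>g. g \<in> carrier G \<Longrightarrow> \<gamma> g \<in> carrier_mat n n"
    and \<gamma>_mult: "\<And>g h. g \<in> carrier G \<Longrightarrow> h \<in> carrier G \<Longrightarrow> \<gamma> (g \<otimes>\<^bsub>G\<^esub> h) = \<gamma> g * \<gamma> h"
    and \<gamma>_one: "\<gamma> \<one>\<^bsub>G\<^esub> = 1\<^sub>m n"
    and inj: "inj_on \<mu> {0..<n}" and \<mu>_neq_0: "\<And>c. c < n \<Longrightarrow> \<mu> c \<noteq> 0"
    and eigen: "\<And>c a j. c < n \<Longrightarrow> a < n \<Longrightarrow> j \<le> m \<Longrightarrow>
      (\<Sum>b\<in>{0..<n}. \<mu> c ^ b * \<gamma> (x j) $$ (b, a)) = \<mu> c * \<mu> c ^ a"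
begin

interpretation group G by (rule group)

text \<open>An eigenvalue of the left factor can be pulled out whatever the right factor h is; this
  freedom is used for words and for inverses.\<close>

lemma eigen_mult:
  assumes "g \<in> carrier G" "h \<in> carrier G" "a < n"
    and "\<And>b. b < n \<Longrightarrow> (\<Sum>l\<in>{0..<n}. \<mu> c ^ l * \<gamma> g $$ (l, b)) = \<kappa> * \<mu> c ^ b"
  shows "(\<Sum>b\<in>{0..<n}. \<mu> c ^ b * \<gamma> (g \<otimes>\<^bsub>G\<^esub> h) $$ (b, a)) =
    \<kappa> * (\<Sum>b\<in>{0..<n}. \<mu> c ^ b * \<gamma> h $$ (b, a))"
proof -
  have "(\<Sum>l\<in>{0..<n}. \<mu> c ^ l * \<gamma> (g \<otimes>\<^bsub>G\<^esub> h) $$ (l, a)) =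
      (\<Sum>l\<in>{0..<n}. \<Sum>b\<in>{0..<n}. \<mu> c ^ l * \<gamma> g $$ (l, b) * \<gamma> h $$ (b, a))"
    using \<gamma>_carrier[OF assms(1)] \<gamma>_carrier[OF assms(2)] assms(3)
    by (intro sum.cong)
      (auto simp: \<gamma>_mult[OF assms(1,2)] scalar_prod_def sum_distrib_left mult.assoc)
  also have "\<dots> = (\<Sum>b\<in>{0..<n}. (\<Sum>l\<in>{0..<n}. \<mu> c ^ l * \<gamma> g $$ (l, b)) * \<gamma> h $$ (b, a))"
    by (subst sum.swap) (simp add: sum_distrib_right)
  also have "\<dots> = \<kappa> * (\<Sum>b\<in>{0..<n}. \<mu> c ^ b * \<gamma> h $$ (b, a))"
    by (simp add: assms(4) sum_distrib_left mult.assoc)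
  finally show ?thesis .
qed

lemma eigen_one: "a < n \<Longrightarrow> (\<Sum>b\<in>{0..<n}. \<mu> c ^ b * \<gamma> \<one>\<^bsub>G\<^esub> $$ (b, a)) = \<mu> c ^ a"
  by (simp add: \<gamma>_one if_distrib[of "times _"] cong: if_cong)

lemma eigen_word:
  assumes "c < n" "fst ` set w \<subseteq> {0..m}" "a < n"
  shows "(\<Sum>b\<in>{0..<n}. \<mu> c ^ b * \<gamma> (word_eval G x w) $$ (b, a)) = \<mu> c powi exponent_sum w * \<mu> c ^ a"
  using assms(2,3)
proof (induction w arbitrary: a)
  case Nil
  then show ?case by (simp add: word_eval_Nil eigen_one)
next
  case (Cons l w)
  have l: "fst l \<le> m" and w: "fst ` set w \<subseteq> {0..m}" using Cons.prems by auto
  have xl: "x (fst l) \<in> carrier G" by (rule x_closed[OF l])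
  \<comment> \<open>\<open>eigen_mult\<close> with h the inverse of g: the product acts trivially,
    so the inverse has the reciprocal eigenvalue.\<close>
  have "(\<Sum>b\<in>{0..<n}. \<mu> c ^ b * \<gamma> (inv\<^bsub>G\<^esub> x (fst l)) $$ (b, a')) = inverse (\<mu> c) * \<mu> c ^ a'" if "a' < n" for a'
    using eigen_mult[OF xl inv_closed[OF xl] that eigen[OF assms(1) _ l]] eigen_one[OF that, of c] xl
      \<mu>_neq_0[OF assms(1)] by (simp add: field_simps)
  then have "(\<Sum>b\<in>{0..<n}. \<mu> c ^ b * \<gamma> (if snd l then x (fst l) else inv\<^bsub>G\<^esub> x (fst l)) $$ (b, a')) =
      \<mu> c powi letter_exp l * \<mu> c ^ a'" if "a' < n" for a'
    using that eigen[OF assms(1) that l] by (simp add: letter_exp_def power_int_minus)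
  then have "(\<Sum>b\<in>{0..<n}. \<mu> c ^ b * \<gamma> (word_eval G x (l # w)) $$ (b, a)) =
      \<mu> c powi letter_exp l * (\<Sum>b\<in>{0..<n}. \<mu> c ^ b * \<gamma> (word_eval G x w) $$ (b, a))"
    unfolding word_eval_Cons using xl Cons.prems(2) by (intro eigen_mult word_eval_closed w) auto
  then show ?case
    using Cons.IH[OF w Cons.prems(2)] \<mu>_neq_0[OF assms(1)] by (simp add: power_int_add)
qed

text \<open>On the eigenvector of \<mu> c a word of exponent sum e acts by t^e (\<mu> c)^e, so
  \<open>Phi_free\<close> acts as the evaluation x_j -> (\<mu> c) t.\<close>

lemma Phi_eigen:
  assumes "c < n" "a < n" "\<And>w. w \<in> Poly_Mapping.keys p \<Longrightarrow> fst ` set w \<subseteq> {0..m}"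
  shows "(\<Sum>b\<in>{0..<n}. const (\<mu> c) ^ b * Phi_free G x n \<epsilon> \<gamma> p $$ (b, a)) =
    laurent p (const (\<mu> c) * tvar) * const (\<mu> c) ^ a"
proof -
  \<comment> \<open>As a ring homomorphism \<open>const\<close> preserves inverses of units, which
    covers negative exponents.\<close>
  have powi: "const (\<mu> c) powi k = const (\<mu> c powi k)" for k
  proof -
    have "const (inverse (\<mu> c)) * const (\<mu> c) = 1"
      using \<mu>_neq_0[OF assms(1)] by (simp flip: const.hom_mult)
    then have "const (inverse (\<mu> c)) = inverse (const (\<mu> c))"
      by (metis inverse_unique mult.commute)
    then show ?thesis by (simp add: power_int_def const.hom_power)
  qed
  have "(\<Sum>b\<in>{0..<n}. const (\<mu> c) ^ b * Phi_free G x n \<epsilon> \<gamma> p $$ (b, a)) =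
      (\<Sum>b\<in>{0..<n}. \<Sum>w\<in>Poly_Mapping.keys p. of_int (Poly_Mapping.lookup p w) * tvar powi exponent_sum w *
        const (\<mu> c ^ b * \<gamma> (word_eval G x w) $$ (b, a)))"
    using assms by (intro sum.cong)
      (auto simp: Phi_free_def Phi_def sum_distrib_left \<epsilon>_word_eval const.hom_mult const.hom_power
        mult_ac intro!: sum.cong)
  also have "\<dots> = (\<Sum>w\<in>Poly_Mapping.keys p. of_int (Poly_Mapping.lookup p w) * tvar powi exponent_sum w *
      const (\<Sum>b\<in>{0..<n}. \<mu> c ^ b * \<gamma> (word_eval G x w) $$ (b, a)))"
    by (subst sum.swap) (simp add: const.hom_sum sum_distrib_left)
  also have "\<dots> = (\<Sum>w\<in>Poly_Mapping.keys p. of_int (Poly_Mapping.lookup p w) * tvar powi exponent_sum w *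
      const (\<mu> c powi exponent_sum w * \<mu> c ^ a))"
    using assms by (intro sum.cong) (simp_all add: eigen_word)
  also have "\<dots> = laurent p (const (\<mu> c) * tvar) * const (\<mu> c) ^ a"
    unfolding laurent_def sum_distrib_right
    by (intro sum.cong) (simp_all add: power_int_mult_distrib powi const.hom_mult const.hom_power mult_ac)
  finally show ?thesis .
qed

abbreviation (input) point :: "nat \<Rightarrow> complex poly fract" where
  "point c \<equiv> const (\<mu> c) * tvar"

lemma inj_const: "inj_on (\<lambda>c. const (\<mu> c)) {0..<n}"
  using inj by (auto simp: inj_on_def const_def)

text \<open>Each factor is the Alexander determinant with t replaced by (\<mu> c) t.\<close>

lemma det_fox_mat0:
  "det (fox_mat0 G m x r n \<epsilon> \<gamma>) =
    (\<Prod>c<n. det (mat m m (\<lambda>(i, j). laurent (fox (Suc j) (r (Suc i))) (point c))))"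
  unfolding fox_mat0_def
proof (rule det_block_mat_eigen[OF inj_const])
  fix c i j a assume "c < n" "i < m" "j < m" "a < n"
  then show "(\<Sum>b\<in>{0..<n}. const (\<mu> c) ^ b * Phi_free G x n \<epsilon> \<gamma> (fox (Suc j) (r (Suc i))) $$ (b, a)) =
      laurent (fox (Suc j) (r (Suc i))) (point c) * const (\<mu> c) ^ a"
    using keys_fox_letters[of "Suc i"] by (intro Phi_eigen) auto
qed

lemma keys_generator_minus_one:
  "w \<in> Poly_Mapping.keys (Poly_Mapping.single [(j, True)] 1 - Poly_Mapping.single [] (1::int)) \<Longrightarrow>
    fst ` set w \<subseteq> {j}"
  using keys_diff[of "Poly_Mapping.single [(j, True)] 1" "Poly_Mapping.single [] (1::int)"] by fastforce

lemma Phi_eigen_generator: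
  assumes "c < n" "a < n" "j \<le> m"
  shows "(\<Sum>b\<in>{0..<n}. const (\<mu> c) ^ b *
      Phi_free G x n \<epsilon> \<gamma> (Poly_Mapping.single [(j, True)] 1 - Poly_Mapping.single [] 1) $$ (b, a)) =
    (point c - 1) * const (\<mu> c) ^ a"
proof -
  have "(\<Sum>b\<in>{0..<n}. const (\<mu> c) ^ b *
      Phi_free G x n \<epsilon> \<gamma> (Poly_Mapping.single [(j, True)] 1 - Poly_Mapping.single [] 1) $$ (b, a)) =
    laurent (Poly_Mapping.single [(j, True)] 1 - Poly_Mapping.single [] 1) (point c) * const (\<mu> c) ^ a"
    using assms keys_generator_minus_one[of _ j] by (intro Phi_eigen) fastforce+
  then show ?thesis by (simp add: laurent_diff letter_exp_def)
qed

text \<open>The top n rows form the block of x_0, so this is the denominator of the Wada invariant,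
  treated as a block matrix with one block.\<close>

lemma det_generator_minus_one:
  "det (mat n n (\<lambda>(i, j). twisted_boundary G m x r n \<epsilon> \<gamma> 1 $$ (i, j))) = (\<Prod>c<n. point c - 1)"
proof -
  let ?\<Phi> = "Phi_free G x n \<epsilon> \<gamma> (Poly_Mapping.single [(0, True)] 1 - Poly_Mapping.single [] 1)"
  have "mat n n (\<lambda>(i, j). twisted_boundary G m x r n \<epsilon> \<gamma> 1 $$ (i, j)) = block_mat n 1 1 (\<lambda>_ _. ?\<Phi>)"
    by (rule eq_matI) (auto simp: twisted_boundary_def index_block_mat)
  also have "det \<dots> = (\<Prod>c<n. det (mat 1 1 (\<lambda>(i::nat, j::nat). point c - 1)))"
    by (rule det_block_mat_eigen[OF inj_const]) (simp add: Phi_eigen_generator)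
  also have "\<dots> = (\<Prod>c<n. point c - 1)"
    by (intro prod.cong refl) (simp add: det_single)
  finally show ?thesis .
qed

text \<open>By the Fox formula \<open>\<Sum>\<^sub>j (\<partial>r/\<partial>x\<^sub>j) (x\<^sub>j - 1) = r - 1\<close>, evaluated at each eigenvalue.\<close>

lemma boundary_boundary:
  "twisted_boundary G m x r n \<epsilon> \<gamma> 2 * twisted_boundary G m x r n \<epsilon> \<gamma> 1 = 0\<^sub>m (m * n) n"
proof (rule eq_matI)
  fix k l assume "k < dim_row (0\<^sub>m (m * n) n :: complex poly fract mat)"
    "l < dim_col (0\<^sub>m (m * n) n :: complex poly fract mat)"
  then have kl: "k < m * n" "l < n" by auto
  define i where "i = k div n"
  have i: "i < m" using kl by (simp add: i_def div_less_mult)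
  let ?F = "\<lambda>j. Phi_free G x n \<epsilon> \<gamma> (fox j (r (Suc i)))"
  let ?X = "\<lambda>j. Phi_free G x n \<epsilon> \<gamma> (Poly_Mapping.single [(j, True)] 1 - Poly_Mapping.single [] 1)"
  \<comment> \<open>The entry of the product in row a of block i and in column l. Pairing with all n
    Vandermonde rows detects whether it vanishes.\<close>
  define z where "z a = (\<Sum>j\<in>{0..<Suc m}. \<Sum>b\<in>{0..<n}. ?F j $$ (a, b) * ?X j $$ (b, l))" for a
  have "(\<Sum>a\<in>{0..<n}. const (\<mu> c) ^ a * z a) = 0" if c: "c < n" for c
  proof -
    have "(\<Sum>a\<in>{0..<n}. const (\<mu> c) ^ a * z a) =
        (\<Sum>j\<in>{0..<Suc m}. \<Sum>a\<in>{0..<n}. \<Sum>b\<in>{0..<n}. const (\<mu> c) ^ a * ?F j $$ (a, b) * ?X j $$ (b, l))"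
      unfolding z_def sum_distrib_left mult.assoc by (rule sum.swap)
    also have "\<dots> = (\<Sum>j\<in>{0..<Suc m}. \<Sum>b\<in>{0..<n}.
        (\<Sum>a\<in>{0..<n}. const (\<mu> c) ^ a * ?F j $$ (a, b)) * ?X j $$ (b, l))"
      unfolding sum_distrib_right by (intro sum.cong refl sum.swap)
    also have "\<dots> = (\<Sum>j\<in>{0..<Suc m}. laurent (fox j (r (Suc i))) (point c) *
        (\<Sum>b\<in>{0..<n}. const (\<mu> c) ^ b * ?X j $$ (b, l)))"
    proof (intro sum.cong refl)
      fix j
      have "(\<Sum>a\<in>{0..<n}. const (\<mu> c) ^ a * ?F j $$ (a, b)) =
          laurent (fox j (r (Suc i))) (point c) * const (\<mu> c) ^ b" if "b < n" for b
        using c that i keys_fox_letters[of "Suc i"] by (intro Phi_eigen) auto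
      then show "(\<Sum>b\<in>{0..<n}. (\<Sum>a\<in>{0..<n}. const (\<mu> c) ^ a * ?F j $$ (a, b)) * ?X j $$ (b, l)) =
          laurent (fox j (r (Suc i))) (point c) * (\<Sum>b\<in>{0..<n}. const (\<mu> c) ^ b * ?X j $$ (b, l))"
        by (simp add: sum_distrib_left mult.assoc)
    qed
    also have "\<dots> = (\<Sum>j\<in>{0..m}. laurent (fox j (r (Suc i))) (point c)) * (point c - 1) * const (\<mu> c) ^ l"
      unfolding sum_distrib_right using c kl
      by (intro sum.cong) (auto simp: Phi_eigen_generator)
    also have "\<dots> = (point c powi exponent_sum (r (Suc i)) - 1) * const (\<mu> c) ^ l"
      using i letters[of "Suc i"] \<mu>_neq_0[OF c] by (subst fox_fundamental_formula) auto
    also have "\<dots> = 0" using i relator[of "Suc i"] by simp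
    finally show ?thesis .
  qed
  from vandermonde_kernel[OF inj_const this mod_less_mult[OF kl(1)]]
  have "z (k mod n) = 0" .
  moreover have "(twisted_boundary G m x r n \<epsilon> \<gamma> 2 * twisted_boundary G m x r n \<epsilon> \<gamma> 1) $$ (k, l) =
      (\<Sum>p\<in>{0..<Suc m * n}. ?F (p div n) $$ (k mod n, p mod n) * ?X (p div n) $$ (p mod n, l))"
    using kl by (auto simp: scalar_prod_def twisted_boundary_def fox_mat_def index_block_mat i_def
      simp del: mult_Suc intro!: sum.cong)
  ultimately show "(twisted_boundary G m x r n \<epsilon> \<gamma> 2 * twisted_boundary G m x r n \<epsilon> \<gamma> 1) $$ (k, l) =
      0\<^sub>m (m * n) n $$ (k, l)"
    using kl by (simp only: sum_div_mod[of "\<lambda>j b. ?F j $$ (k mod n, b) * ?X j $$ (b, l)"] z_def)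
      simp
qed (auto simp: twisted_boundary_def fox_mat_def)

text \<open>The torsion as Wada invariant, with both determinants split over the eigenvalues. The
  sign comes from the row permutation in the middle degree.\<close>

theorem twisted_torsion_eq:
  assumes "\<And>c. c < n \<Longrightarrow> det (mat m m (\<lambda>(i, j). laurent (fox (Suc j) (r (Suc i))) (point c))) \<noteq> 0"
  shows "twisted_torsion G m x r n \<epsilon> \<gamma> = (- 1) ^ (n * (m * n)) *
    (\<Prod>c<n. det (mat m m (\<lambda>(i, j). laurent (fox (Suc j) (r (Suc i))) (point c))) / (point c - 1))"
proof -
  have div: "(n + j) div n = Suc (j div n)" if "j < m * n" for j
    using that by (cases "n = 0") auto
  \<comment> \<open>Dropping the first n columns deletes the block column of x_0, which shifts the
    generator index by one.\<close>
  have fox_mat0: "mat (m * n) (m * n) (\<lambda>(i, j). twisted_boundary G m x r n \<epsilon> \<gamma> 2 $$ (i, n + j)) =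
      fox_mat0 G m x r n \<epsilon> \<gamma>"
    by (rule eq_matI)
      (auto simp: twisted_boundary_def fox_mat_def fox_mat0_def index_block_mat div)
  have "reidemeister_torsion 2 (twisted_dim m n) (twisted_boundary G m x r n \<epsilon> \<gamma>) =
      (- 1) ^ (n * (m * n)) *
      det (mat (m * n) (m * n) (\<lambda>(i, j). twisted_boundary G m x r n \<epsilon> \<gamma> 2 $$ (i, n + j))) /
      det (mat n n (\<lambda>(i, j). twisted_boundary G m x r n \<epsilon> \<gamma> 1 $$ (i, j)))"
  proof (rule reidemeister_torsion_length_two)
    show "twisted_boundary G m x r n \<epsilon> \<gamma> 1 \<in> carrier_mat (n + m * n) n"
      "twisted_boundary G m x r n \<epsilon> \<gamma> 2 \<in> carrier_mat (m * n) (n + m * n)"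
      by (auto simp: twisted_boundary_def fox_mat_def)
    show "det (mat n n (\<lambda>(i, j). twisted_boundary G m x r n \<epsilon> \<gamma> 1 $$ (i, j))) \<noteq> 0"
      unfolding det_generator_minus_one by (simp add: const_tvar_neq_1)
    show "det (mat (m * n) (m * n) (\<lambda>(i, j). twisted_boundary G m x r n \<epsilon> \<gamma> 2 $$ (i, n + j))) \<noteq> 0"
      unfolding fox_mat0 det_fox_mat0 using assms by simp
  qed (simp_all add: twisted_dim_def boundary_boundary[simplified])
  then show ?thesis
    unfolding twisted_torsion_def fox_mat0 det_fox_mat0 det_generator_minus_one
    by (simp add: prod_dividef)
qed

end


section \<open>Reciprocal polynomials\<close>

lemma eq_unitI: "\<sigma> = 1 \<or> \<sigma> = -1 \<Longrightarrow> p = \<sigma> * tvar powi k * q \<Longrightarrow> p \<doteq> q"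
  by (auto simp: eq_unit_def)

lemma eq_unitE:
  assumes "p \<doteq> q"
  obtains \<sigma> k where "\<sigma> = 1 \<or> \<sigma> = -1" "p = \<sigma> * tvar powi k * q"
proof -
  from assms obtain k where "p = 1 * tvar powi k * q \<or> p = -1 * tvar powi k * q"
    by (auto simp: eq_unit_def)
  then show thesis using that[of 1 k] that[of "-1" k] by auto
qed

lemma reciprocal_mult:
  assumes "reciprocal p" "reciprocal q"
  shows "reciprocal (p * q)"
proof -
  obtain \<sigma> k \<sigma>' k' where "\<sigma> = 1 \<or> \<sigma> = -1" "\<sigma>' = 1 \<or> \<sigma>' = -1"
      "eval_int_poly p (inverse tvar) = \<sigma> * tvar powi k * eval_int_poly p tvar"
      "eval_int_poly q (inverse tvar) = \<sigma>' * tvar powi k' * eval_int_poly q tvar"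
    using assms unfolding reciprocal_def by (metis eq_unitE)
  then show ?thesis
    unfolding reciprocal_def
    by (intro eq_unitI[of "\<sigma> * \<sigma>'" _ "k + k'"]) (auto simp: power_int_add)
qed

text \<open>Divides the functional equation of p q by that of p. Its contrapositive carries
  non-reciprocity from a factor to the product.\<close>

lemma reciprocal_cancel:
  assumes "reciprocal p" "reciprocal (p * q)" "p \<noteq> 0"
  shows "reciprocal q"
proof -
  obtain \<sigma> k \<sigma>' k' where \<sigma>: "\<sigma> = 1 \<or> \<sigma> = -1" "\<sigma>' = 1 \<or> \<sigma>' = -1" and
      p: "eval_int_poly p (inverse tvar) = \<sigma> * tvar powi k * eval_int_poly p tvar" and
      pq: "eval_int_poly (p * q) (inverse tvar) = \<sigma>' * tvar powi k' * eval_int_poly (p * q) tvar"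
    using assms unfolding reciprocal_def by (metis eq_unitE)
  have "\<sigma> * tvar powi k * eval_int_poly q (inverse tvar) = \<sigma>' * tvar powi k' * eval_int_poly q tvar"
    using pq p assms(3) by (simp add: mult.assoc)
  moreover have "\<sigma> * \<sigma> = 1" using \<sigma> by auto
  ultimately have "tvar powi k * eval_int_poly q (inverse tvar) =
      \<sigma> * (\<sigma>' * tvar powi k' * eval_int_poly q tvar)"
    by (metis mult.assoc mult_1)
  then have "eval_int_poly q (inverse tvar) =
      \<sigma> * \<sigma>' * tvar powi (k' - k) * eval_int_poly q tvar"
    by (simp add: power_int_diff field_simps)
  then show ?thesis
    unfolding reciprocal_def using \<sigma> by (intro eq_unitI[of "\<sigma> * \<sigma>'" _ "k' - k"]) auto
qed

text \<open>The unit is a/t, because a^2 = 1.\<close>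

lemma reciprocal_linear: "a = 1 \<or> a = -1 \<Longrightarrow> reciprocal [:a, 1:]"
  unfolding reciprocal_def
  by (intro eq_unitI[of "of_int a" _ "-1"]) (auto simp: power_int_minus field_simps)

lemma reciprocal_quadratic: "reciprocal [:1, a, 1:]"
  unfolding reciprocal_def
  by (intro eq_unitI[of 1 _ "-2"]) (auto simp: power_int_minus field_simps power2_eq_square)


section \<open>The torsion polynomial\<close>

text \<open>The roots of \<open>f\<close> are \<open>A\<close> and \<open>B = -1/A\<close>, so every factor of \<open>f(s) f(1/s)\<close> at
  \<open>s = T, AT, BT\<close> is a multiple of a linear polynomial in \<open>T\<close>, and \<open>A\<^sup>2 + B\<^sup>2 = 3\<close>.\<close>

lemma torsion_product:
  fixes A B T a :: "'k::field"
  defines "f \<equiv> \<lambda>s. s ^ 2 + a * s - 1"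
  assumes AB: "A * B = -1" and sum: "A + B = - a" and a: "a ^ 2 = 1" and "T \<noteq> 0"
  shows "(f T * f (inverse T)) * (f (A * T) * f (inverse (A * T))) * (f (B * T) * f (inverse (B * T))) =
    T powi (-6) * ((T - 1) * ((T + 1) ^ 2 * f T * ((T ^ 2 + 3 * T + 1) * (T ^ 2 - 3 * T + 1)))) *
      ((T - 1) * (A * T - 1) * (B * T - 1))"
proof -
  have f: "f s = (s - A) * (s - B)" for s
  proof -
    have "(s - A) * (s - B) = s ^ 2 - (A + B) * s + A * B"
      by (simp add: algebra_simps power2_eq_square)
    then show ?thesis by (simp add: f_def AB sum)
  qed
  have nz: "A \<noteq> 0" "B \<noteq> 0" using AB by auto
  \<comment> \<open>Supplies two of the three denominator factors to be cancelled; the third is one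
    of the two factors T - 1 coming from \<open>scaled\<close>.\<close>
  have fT: "f (inverse T) = T powi (-2) * ((A * T - 1) * (B * T - 1))"
    unfolding f using \<open>T \<noteq> 0\<close> by (simp add: power_int_minus field_simps power2_eq_square)
  \<comment> \<open>C is one root of f and D the other. From CD = -1 follows CT - D = C (T + D^2),
    and the powers of C cancel between the two values of f.\<close>
  have scaled: "f (C * T) * f (inverse (C * T)) =
      T powi (-2) * ((T - 1) * (T + 1) * (T + D ^ 2) * (1 - C ^ 2 * T))"
    if "C * D = -1" "\<And>s. f s = (s - C) * (s - D)" for C D
  proof -
    have "C \<noteq> 0" using that by auto
    have CD: "C * D ^ 2 = - D"
      using that(1) by (simp add: power2_eq_square flip: mult.assoc)
    have "C * (T + D ^ 2) = C * T - D" "C * (T - 1) = C * T - C"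
      by (simp_all add: distrib_left right_diff_distrib CD)
    then have "f (C * T) = (C * (T - 1)) * (C * (T + D ^ 2))"
      by (simp only: that(2))
    then have "f (C * T) = C ^ 2 * ((T - 1) * (T + D ^ 2))"
      by (simp only: power2_eq_square mult_ac)
    moreover have "f (inverse (C * T)) = inverse ((C * T) ^ 2) * ((1 - C ^ 2 * T) * (T + 1))"
    proof -
      have "f (inverse (C * T)) = inverse ((C * T) ^ 2) * ((1 - C * (C * T)) * (1 - (C * D) * T))"
        unfolding that(2) using \<open>C \<noteq> 0\<close> \<open>T \<noteq> 0\<close> by (simp add: field_simps power2_eq_square)
      then show ?thesis by (simp add: that(1) power2_eq_square mult.assoc add.commute)
    qed
    ultimately have "f (C * T) * f (inverse (C * T)) = (C ^ 2 * inverse ((C * T) ^ 2)) *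
        ((T - 1) * (T + 1) * (T + D ^ 2) * (1 - C ^ 2 * T))"
      by (simp only: mult_ac)
    moreover have "C ^ 2 * inverse ((C * T) ^ 2) = T powi (-2)"
      using \<open>C \<noteq> 0\<close> by (simp add: power_int_minus power_mult_distrib)
    ultimately show ?thesis by simp
  qed
  \<comment> \<open>Here 3 = a^2 + 2, from A + B = -a and AB = -1.\<close>
  have sq: "A ^ 2 + B ^ 2 = 3"
  proof -
    have "A ^ 2 + B ^ 2 = (A + B) ^ 2 - 2 * (A * B)" by (simp add: power2_eq_square algebra_simps)
    then show ?thesis by (simp add: AB sum a)
  qed
  have sq': "A ^ 2 * B ^ 2 = 1" using AB by (simp flip: power_mult_distrib)
  have q1: "(T + B ^ 2) * (T + A ^ 2) = T ^ 2 + 3 * T + 1"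
  proof -
    have "(T + B ^ 2) * (T + A ^ 2) = T ^ 2 + (A ^ 2 + B ^ 2) * T + A ^ 2 * B ^ 2"
      by (simp add: algebra_simps power2_eq_square)
    then show ?thesis by (simp only: sq sq')
  qed
  have q2: "(1 - A ^ 2 * T) * (1 - B ^ 2 * T) = T ^ 2 - 3 * T + 1"
  proof -
    have "(1 - A ^ 2 * T) * (1 - B ^ 2 * T) = 1 - (A ^ 2 + B ^ 2) * T + (A ^ 2 * B ^ 2) * T ^ 2"
      by (simp add: algebra_simps power2_eq_square)
    then show ?thesis by (simp only: sq sq') simp
  qed
  have "T powi (-6) = T powi (-2) * T powi (-2) * T powi (-2)"
    using \<open>T \<noteq> 0\<close> by (simp flip: power_int_add)
  moreover have "f (A * T) * f (inverse (A * T)) =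
      T powi (-2) * ((T - 1) * (T + 1) * (T + B ^ 2) * (1 - A ^ 2 * T))"
    using AB f by (rule scaled)
  moreover have "f (B * T) * f (inverse (B * T)) =
      T powi (-2) * ((T - 1) * (T + 1) * (T + A ^ 2) * (1 - B ^ 2 * T))"
    using AB f by (intro scaled) (simp_all add: mult.commute)
  ultimately show ?thesis
    unfolding fT q1[symmetric] q2[symmetric] power2_eq_square[of "T + 1"] by (simp only: mult_ac)
qed

text \<open>The eigenvalues are n distinct nonzero complex roots of q. The integral matrices are
  viewed over the complex numbers, where these roots lie.\<close>

lemma (in meridional_presentation) companion_representation:
  fixes q :: "int poly"
  assumes q: "lead_coeff q = 1" "degree q = n"
    and \<gamma>: "\<gamma> \<in> hom G (GL_int n)" "\<And>j. j \<le> m \<Longrightarrow> \<gamma> (x j) = companion q"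
    and \<mu>: "inj_on \<mu> {0..<n}" "\<And>c. c < n \<Longrightarrow> \<mu> c \<noteq> 0"
      "\<And>c. c < n \<Longrightarrow> eval_int_poly q (\<mu> c) = 0"
  shows "cyclic_representation G m x r \<epsilon> n (\<lambda>g. map_mat complex_of_int (\<gamma> g)) \<mu>"
proof -
  interpret G: group G by (rule group)
  interpret R: ring "ring_mat TYPE(int) n ()" by (rule ring_mat)
  have GL: "group (GL_int n)" unfolding GL_int_def by (rule R.units_group)
  have carrier: "\<gamma> g \<in> carrier_mat n n" if "g \<in> carrier G" for g
    using hom_in_carrier[OF \<gamma>(1) that]
    by (auto simp: GL_int_def units_of_carrier Units_def ring_mat_def)
  have "\<gamma> \<one>\<^bsub>G\<^esub> = 1\<^sub>m n"
    using group_hom.hom_one[of G "GL_int n" \<gamma>] \<gamma>(1) group GL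
    by (simp add: group_hom_def group_hom_axioms_def GL_int_def units_of_one ring_mat_def)
  moreover have "map_mat complex_of_int (\<gamma> (g \<otimes>\<^bsub>G\<^esub> h)) =
      map_mat complex_of_int (\<gamma> g) * map_mat complex_of_int (\<gamma> h)"
    if "g \<in> carrier G" "h \<in> carrier G" for g h
    using hom_mult[OF \<gamma>(1) that] of_int_hom.mat_hom_mult[OF carrier[OF that(1)] carrier[OF that(2)]]
    by (simp add: GL_int_def units_of_mult ring_mat_def)
  moreover have "(\<Sum>b\<in>{0..<n}. \<mu> c ^ b * map_mat complex_of_int (companion q) $$ (b, a)) = \<mu> c * \<mu> c ^ a"
    if "c < n" "a < n" for c a
  proof -
    have "degree (map_poly complex_of_int q) = n" unfolding q(2)[symmetric] by (rule degree_map_poly) simp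
    then show ?thesis
      using companion_left_eigenvector[of "map_poly complex_of_int q" "\<mu> c" a] q \<mu>(3)[OF that(1)] that(2)
      by (simp add: map_mat_companion eval_int_poly_def coeff_map_poly)
  qed
  ultimately show ?thesis
    using carrier \<gamma>(2) \<mu>(1,2) by unfold_locales
      (auto simp: of_int_hom.mat_hom_one)
qed

theorem proposition2p3:
  fixes f :: "int poly"
    and K :: "(complex \<times> complex) set"
    and \<nu> :: "complex \<times> complex \<Rightarrow> complex \<times> complex"
    and p :: "complex \<times> complex"
    and m :: nat
    and x :: "nat \<Rightarrow> (real \<Rightarrow> complex \<times> complex) set"
    and r :: "nat \<Rightarrow> nat word"
    and \<epsilon> :: "(real \<Rightarrow> complex \<times> complex) set \<Rightarrow> int"
    and \<gamma> :: "(real \<Rightarrow> complex \<times> complex) set \<Rightarrow> int mat"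
  defines "G \<equiv> fundamental_group (exterior \<nu>) p"
  assumes "degree f = 2" and "lead_coeff f = 1" and "coeff f 0 = -1"
    and "poly f 1 = 1 \<or> poly f 1 = -1"
    and "tubular_neighbourhood K \<nu>" and "p \<in> exterior \<nu>"
    and "wirtinger_presentation \<nu> p m x r"
    and "\<epsilon> \<in> hom G integer_group" and "\<And>j. j \<le> m \<Longrightarrow> \<epsilon> (x j) = 1"
    and "alexander_polynomial G m x r \<epsilon> \<doteq> eval_int_poly f tvar * eval_int_poly f (inverse tvar)"
    and "\<gamma> \<in> hom G (GL_int 3)" and "\<And>j. j \<le> m \<Longrightarrow> \<gamma> (x j) = companion ([:-1, 1:] * f)"
    and "\<not> reciprocal f"
  shows "\<exists>h :: int poly.
    twisted_torsion G m x r 3 \<epsilon> (\<lambda>g. map_mat complex_of_int (\<gamma> g))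
      \<doteq> eval_int_poly ([:-1, 1:] * h) tvar \<and>
    \<not> reciprocal ([:-1, 1:] * h)"
proof -

  \<comment> \<open>The quadratic f and its roots\<close>
  define a where "a = coeff f 1"
  have f: "f = [:-1, a, 1:]"
  proof (rule poly_eqI)
    fix i
    show "coeff f i = coeff [:-1, a, 1:] i"
      using assms(2-4) coeff_eq_0[of f i]
      by (cases "i = 0"; cases "i = 1"; cases "i = 2")
        (auto simp: a_def coeff_pCons split: nat.split)
  qed
  \<comment> \<open>The value of f at 1 is -1 + a + 1 = a.\<close>
  have a: "a = 1 \<or> a = -1" using assms(5) by (simp add: f)
  have a2: "(of_int a :: 'b::comm_ring_1) ^ 2 = 1" using a by auto
  have eval_f: "eval_int_poly f s = s ^ 2 + of_int a * s - 1" for s :: "'b::comm_ring_1"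
    by (simp add: f algebra_simps power2_eq_square)
  \<comment> \<open>The discriminant of f is a^2 + 4 = 5.\<close>
  define \<alpha> \<beta> where "\<alpha> = (complex_of_real (sqrt 5) - of_int a) / 2"
    and "\<beta> = (- complex_of_real (sqrt 5) - of_int a) / 2"
  have sqrt5: "complex_of_real (sqrt 5) * complex_of_real (sqrt 5) = 5"
    by (simp flip: of_real_mult)
  have sum: "\<alpha> + \<beta> = - of_int a" by (simp add: \<alpha>_def \<beta>_def field_simps)
  have prod: "\<alpha> * \<beta> = -1"
    using a sqrt5 by (auto simp: \<alpha>_def \<beta>_def field_simps)
  have \<alpha>_\<beta>: "\<alpha> \<noteq> \<beta>" by (simp add: \<alpha>_def \<beta>_def)
  have eval_f': "eval_int_poly f s = (s - \<alpha>) * (s - \<beta>)" for s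
  proof -
    have "(s - \<alpha>) * (s - \<beta>) = s ^ 2 - (\<alpha> + \<beta>) * s + \<alpha> * \<beta>"
      by (simp add: algebra_simps power2_eq_square)
    then show ?thesis by (simp add: eval_f sum prod)
  qed
  define \<mu> where "\<mu> c = [1, \<alpha>, \<beta>] ! c" for c
  have three: "{0..<3} = {0, Suc 0, 2}" "{..<3} = {0, Suc 0, 2}" by auto
  have \<mu>: "\<mu> 0 = 1" "\<mu> (Suc 0) = \<alpha>" "\<mu> 2 = \<beta>" by (simp_all add: \<mu>_def)
  have less3: "c = 0 \<or> c = Suc 0 \<or> c = 2" if "c < 3" for c :: nat using that by linarith
  \<comment> \<open>So 1 is no root of f, and (t - 1) f(t) has three distinct roots.\<close>
  have "eval_int_poly f (1::complex) \<noteq> 0" using a by (auto simp: f)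
  then have inj: "inj_on \<mu> {0..<3}"
    using \<alpha>_\<beta> unfolding three eval_f' by (auto simp: inj_on_def \<mu>)

  \<comment> \<open>The presentation and its cyclic representation\<close>
  have presentation: "is_presentation G {0..m} x (r ` {1..m})"
    and relators: "\<And>i. i \<in> {1..m} \<Longrightarrow> wirtinger_relator {0..m} (r i)"
    using assms(8) by (auto simp: wirtinger_presentation_def G_def)
  interpret meridional_presentation G m x r \<epsilon>
  proof (rule meridional_presentation.intro)
    show "group G" "x \<in> {0..m} \<rightarrow> carrier G"
      using presentation by (auto simp: is_presentation_def)
    fix i assume i: "i \<in> {1..m}"
    show "exponent_sum (r i) = 0"
      using relators[OF i] by (rule exponent_sum_wirtinger_relator)
    have "r i \<in> carrier (free_group {0..m})"
      using presentation i by (auto simp: is_presentation_def)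
    then show "fst ` set (r i) \<subseteq> {0..m}"
      by (simp add: free_group_def)
  qed (use assms(9,10) in auto)
  let ?q = "[:-1, 1:] * f"
  have q: "lead_coeff ?q = 1" "degree ?q = 3" by (simp_all add: f)
  interpret cyclic_representation G m x r \<epsilon> 3 "\<lambda>g. map_mat complex_of_int (\<gamma> g)" \<mu>
  proof (rule companion_representation[OF q assms(12,13) inj])
    fix c :: nat assume "c < 3"
    then show "\<mu> c \<noteq> 0" "eval_int_poly ?q (\<mu> c) = 0"
      using less3[of c] prod by (auto simp: \<mu> eval_f' simp del: mult_pCons_left)
  qed

  \<comment> \<open>The Alexander determinant at t, \<alpha>t and \<beta>t\<close>
  define \<Lambda> where "\<Lambda> s = det (mat m m (\<lambda>(i, j). laurent (fox (Suc j) (r (Suc i))) s))"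
    for s :: "complex poly fract"
  obtain \<sigma> k :: int where \<sigma>: "\<sigma> = 1 \<or> \<sigma> = -1" and \<Lambda>: "\<And>s. s \<noteq> 0 \<Longrightarrow>
      \<Lambda> s = of_int \<sigma> * s powi k * (eval_int_poly f s * eval_int_poly f (inverse s))"
    using det_laurent_substitute[of m "\<lambda>i j. fox (Suc j) (r (Suc i))" f] assms(11)
    unfolding alexander_polynomial_eq \<Lambda>_def by metis
  let ?A = "const \<alpha>" and ?B = "const \<beta>" and ?T = tvar
  have nz: "?A \<noteq> 0" "?B \<noteq> 0" using prod by auto
  have AB: "?A * ?B = -1" and AB_sum: "?A + ?B = - of_int a"
    by (simp_all add: prod sum const.hom_uminus const.hom_of_int flip: const.hom_mult const.hom_add)
  \<comment> \<open>What \<open>torsion_product\<close> leaves, up to a power of t, after removing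
    the denominator and one factor t - 1.\<close>
  define h where "h = [:1, 1:] ^ 2 * f * ([:1, 3, 1:] * [:1, -3, 1:])"
  have eval_h: "eval_int_poly ([:-1, 1:] * h) ?T = (?T - 1) * ((?T + 1) ^ 2 *
      (?T ^ 2 + of_int a * ?T - 1) * ((?T ^ 2 + 3 * ?T + 1) * (?T ^ 2 - 3 * ?T + 1)))"
    unfolding h_def power2_eq_square[of "[:1, 1:]"] eval_int_poly_mult eval_f
    by (simp add: algebra_simps power2_eq_square)
  \<comment> \<open>Collects the sign of \<open>twisted_torsion_eq\<close>, one \<sigma> from each
    of the three values, and (\<alpha>\<beta>)^k = (-1)^k.\<close>
  define u where "u = (-1) ^ (3 * (m * 3)) * (of_int \<sigma> ^ 3 * (-1) powi k :: complex poly fract)"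
  have u: "u = 1 \<or> u = -1"
    using \<sigma> by (auto simp: u_def minus_one_power_iff power_int_minus_left)
  \<comment> \<open>The exponent 3k - 6 has k from each Alexander factor and -6 from
    \<open>torsion_product\<close>.\<close>
  have prod_\<Lambda>: "\<Lambda> ?T * \<Lambda> (?A * ?T) * \<Lambda> (?B * ?T) = of_int \<sigma> ^ 3 * (-1) powi k * ?T powi (3 * k - 6) *
      eval_int_poly ([:-1, 1:] * h) ?T * ((?T - 1) * (?A * ?T - 1) * (?B * ?T - 1))"
  proof -
    have "?T powi k * (?A * ?T) powi k * (?B * ?T) powi k = (?A * ?B) powi k * ?T powi (3 * k)"
      by (simp add: power_int_mult_distrib power_int_mult mult_ac power3_eq_cube)
    then have units: "?T powi k * (?A * ?T) powi k * (?B * ?T) powi k = (-1) powi k * ?T powi (3 * k)"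
      by (simp only: AB)
    have "\<Lambda> ?T * \<Lambda> (?A * ?T) * \<Lambda> (?B * ?T) = of_int \<sigma> ^ 3 *
        (?T powi k * (?A * ?T) powi k * (?B * ?T) powi k) *
        ((eval_int_poly f ?T * eval_int_poly f (inverse ?T)) *
         (eval_int_poly f (?A * ?T) * eval_int_poly f (inverse (?A * ?T))) *
         (eval_int_poly f (?B * ?T) * eval_int_poly f (inverse (?B * ?T))))"
      using nz by (simp only: \<Lambda> mult_eq_0_iff tvar_neq_0 power3_eq_cube mult_ac simp_thms)
    also have "\<dots> = of_int \<sigma> ^ 3 * ((-1) powi k * ?T powi (3 * k)) * (?T powi (-6) *
        eval_int_poly ([:-1, 1:] * h) ?T * ((?T - 1) * (?A * ?T - 1) * (?B * ?T - 1)))"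
      unfolding units eval_f eval_h by (subst torsion_product[OF AB AB_sum a2]) simp_all
    also have "?T powi (3 * k - 6) = ?T powi (3 * k) * ?T powi (-6)"
      by (simp flip: power_int_add)
    ultimately show ?thesis by (simp only: mult_ac)
  qed
  have "h \<noteq> 0" by (simp add: h_def f del: mult_pCons_left mult_pCons_right)
  have den: "(?T - 1) * (?A * ?T - 1) * (?B * ?T - 1) \<noteq> 0"
    using const_tvar_neq_1[of 1] by (simp add: const_tvar_neq_1)
  \<comment> \<open>A nonzero product has nonzero factors, which is the hypothesis of
    \<open>twisted_torsion_eq\<close>.\<close>
  have "\<Lambda> ?T * \<Lambda> (?A * ?T) * \<Lambda> (?B * ?T) \<noteq> 0"
    unfolding prod_\<Lambda> using \<sigma> den \<open>h \<noteq> 0\<close> by (auto simp del: mult_pCons_left)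
  then have nonzero: "\<Lambda> (const (\<mu> c) * ?T) \<noteq> 0" if "c < 3" for c
    using less3[OF that] by (auto simp: \<mu>)
  have "twisted_torsion G m x r 3 \<epsilon> (\<lambda>g. map_mat complex_of_int (\<gamma> g)) =
      (-1) ^ (3 * (m * 3)) * (\<Prod>c<3. \<Lambda> (const (\<mu> c) * ?T) / (const (\<mu> c) * ?T - 1))"
    using nonzero unfolding \<Lambda>_def by (rule twisted_torsion_eq)
  also have "\<dots> = (-1) ^ (3 * (m * 3)) * (\<Lambda> ?T * \<Lambda> (?A * ?T) * \<Lambda> (?B * ?T) /
      ((?T - 1) * (?A * ?T - 1) * (?B * ?T - 1)))"
    by (simp add: three \<mu> mult.assoc)
  also have "\<dots> = u * ?T powi (3 * k - 6) * eval_int_poly ([:-1, 1:] * h) ?T"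
    unfolding prod_\<Lambda> u_def using den by simp
  finally have "twisted_torsion G m x r 3 \<epsilon> (\<lambda>g. map_mat complex_of_int (\<gamma> g)) \<doteq>
      eval_int_poly ([:-1, 1:] * h) ?T"
    by (rule eq_unitI[OF u])

  \<comment> \<open>Non-reciprocity of the torsion\<close>
  moreover have "\<not> reciprocal ([:-1, 1:] * h)"
  proof
    assume "reciprocal ([:-1, 1:] * h)"
    \<comment> \<open>The cofactor of f is a product of reciprocal polynomials, so cancelling it
      would make f reciprocal.\<close>
    moreover define g :: "int poly" where
      "g = [:-1, 1:] * ([:1, 1:] * ([:1, 1:] * ([:1, 3, 1:] * [:1, -3, 1:])))"
    moreover have "[:-1, 1:] * h = g * f"
      unfolding h_def g_def power2_eq_square by (simp only: mult_ac)
    moreover have "reciprocal g"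
      unfolding g_def by (intro reciprocal_mult reciprocal_linear reciprocal_quadratic) auto
    moreover have "g \<noteq> 0" by (simp add: g_def)
    ultimately show False using reciprocal_cancel[of g f] assms(14) by simp
  qed
  ultimately show ?thesis by blast
qed

end
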